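(* For each of the following five sets, any element of $G\Gamma_\sharp$ can be uniquely expressed as an infinite $\mathbb{Q}(\beta)$-linear combination of elements from that set: (i) $\{p_\lambda^{(\beta)}\}_{\lambda \in \mathcal{OP}}$; (ii) $\{q_\lambda^{(\beta)}\}_{\lambda \in \mathcal{OP}}$; (iii) $\{\overline{q}_\lambda^{(\beta)}\}_{\lambda \in \mathcal{OP}}$; (iv) $\{q_\lambda^{(\beta)}\}_{\lambda \in \mathcal{SP}}$; (v) $\{\overline{q}_\lambda^{(\beta)}\}_{\lambda \in \mathcal{SP}}$.
   Context: $\beta$ is a formal parameter, and $\overline{u} := \frac{-u}{1+\beta u}$ (expanded as a power series in $u$). Let $x=(x_1,x_2,\dots)$ be infinitely many variables and $p_i=p_i(x)=\sum_j x_j^i$. $\widehat{\Lambda}_\sharp$ is the $\mathbb{Q}(\beta)$-algebra of all formal infinite sums $\sum_{n\ge 0}\sum_{|\lambda|=n} c_\lambda\, p_{\lambda_1}p_{\lambda_2}\cdots p_{\lambda_{\ell(\lambda)}}$ over partitions $\lambda$, with $c_\lambda\in\mathbb{Q}(\beta)$ arbitrary (i.e. the direct product over $n$ of the spaces of degree-$n$ symmetric functions over $\mathbb{Q}(\beta)$). An element $f\in\widehat{\Lambda}_\sharp$ satisfies the $K$-$Q$-cancellation property if $f(t,\overline{t},x_3,x_4,\dots)$ is independent of $t$. $G\Gamma_\sharp\subset\widehat{\Lambda}_\sharp$ is the subalgebra of elements satisfying the $K$-$Q$-cancellation property. Define $p_n^{(\beta)}(x) = p_n\big(\tfrac{x_1}{1+\frac{\beta}{2}x_1},\tfrac{x_2}{1+\frac{\beta}{2}x_2},\dots\big)=\sum_{k\ge0}\binom{-n}{k}(\tfrac{\beta}{2})^k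 p_{n+k}(x)$, define $q_n^{(\beta)}(x)$ by $\sum_{n\ge0} q_n^{(\beta)}(x)z^n=\prod_i\frac{1-\overline{x_i}z}{1-x_iz}$, and $\overline{q}_n^{(\beta)}(x):=q_n^{(\beta)}(\overline{x_1},\overline{x_2},\dots)$. For a partition $\lambda$, put $p_\lambda^{(\beta)}=\prod_i p_{\lambda_i}^{(\beta)}$, $q_\lambda^{(\beta)}=\prod_i q_{\lambda_i}^{(\beta)}$, $\overline{q}_\lambda^{(\beta)}=\prod_i \overline{q}_{\lambda_i}^{(\beta)}$ (products over the parts of $\lambda$; the empty partition gives $1$). $\mathcal{OP}$ is the set of partitions all of whose parts are odd, and $\mathcal{SP}$ the set of partitions with distinct parts (both including the empty partition). Infinite linear combinations are taken in $\widehat{\Lambda}_\sharp$, in the sense of convergence in each degree (each homogeneous component is a finite sum). *)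

theory Defs
  imports
    "HOL-Computational_Algebra.Formal_Power_Series"
    "HOL-Computational_Algebra.Fraction_Field"
    "HOL-Computational_Algebra.Polynomial"
    "HOL-Library.Multiset"
begin

section \<open>Formal power series in infinitely many variables\<close>

text \<open>
  The variables are indexed by \<^typ>\<open>nat\<close>, so that variable \<open>i\<close> is the \<open>x\<^sub>i\<^sub>+\<^sub>1\<close> of the usual
  convention. A monomial is the multiset of its variables: \<open>count m i\<close> is the exponent of variable
  \<open>i\<close>, \<open>size m\<close> is the degree, and the product of monomials is the sum of multisets. A power series
  is an arbitrary family of coefficients.
\<close>

typedef 'a mvps = "UNIV :: (nat multiset \<Rightarrow> 'a) set"
  morphisms mv_coeff Abs_mvps
  by simp

lemma mv_coeff_Abs [simp]: "mv_coeff (Abs_mvps f) = f"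
  by (simp add: Abs_mvps_inverse)

lemma mvps_eqI: "(\<And>m. mv_coeff f m = mv_coeff g m) \<Longrightarrow> f = g"
  by (metis ext mv_coeff_inject)

definition splits :: "nat multiset \<Rightarrow> (nat multiset \<times> nat multiset) set" where
  "splits m = {(a, b). a + b = m}"

lemma finite_splits [simp]: "finite (splits m)"
proof -
  let ?D = "\<Union>n\<le>size m. multisets_of_size (set_mset m) n"
  have "splits m \<subseteq> ?D \<times> ?D"
    by (auto simp: splits_def multisets_of_size_def)
  moreover have "finite ?D"
    by auto
  ultimately show ?thesis
    by (meson finite_SigmaI finite_subset)
qed

lemma splits_empty [simp]: "splits {#} = {({#}, {#})}"
  by (auto simp: splits_def)

instantiation mvps :: (comm_ring_1) comm_ring_1
begin

definition "0 = Abs_mvps (\<lambda>_. 0)"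
definition "1 = Abs_mvps (\<lambda>m. if m = {#} then 1 else 0)"
definition "f + g = Abs_mvps (\<lambda>m. mv_coeff f m + mv_coeff g m)"
definition "f - g = Abs_mvps (\<lambda>m. mv_coeff f m - mv_coeff g m)"
definition "- f = Abs_mvps (\<lambda>m. - mv_coeff f m)"
definition "f * g = Abs_mvps (\<lambda>m. \<Sum>(a, b)\<in>splits m. mv_coeff f a * mv_coeff g b)"

instance
proof
  fix f g h :: "'a mvps"
  show "f * g * h = f * (g * h)"
  proof (rule mvps_eqI)
    fix m
    have "mv_coeff (f * g * h) m =
        (\<Sum>p\<in>splits m. \<Sum>q\<in>splits (fst p).
          mv_coeff f (fst q) * mv_coeff g (snd q) * mv_coeff h (snd p))"
      by (simp add: times_mvps_def case_prod_unfold sum_distrib_right)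
    also have "\<dots> = (\<Sum>(p, q)\<in>(SIGMA p:splits m. splits (fst p)).
          mv_coeff f (fst q) * mv_coeff g (snd q) * mv_coeff h (snd p))"
      by (subst sum.Sigma) auto
    also have "\<dots> = (\<Sum>(p, q)\<in>(SIGMA p:splits m. splits (snd p)).
          mv_coeff f (fst p) * (mv_coeff g (fst q) * mv_coeff h (snd q)))"
      by (rule sum.reindex_bij_witness[of _
            "\<lambda>(p, q). ((fst p + fst q, snd q), (fst p, fst q))"
            "\<lambda>(p, q). ((fst q, snd q + snd p), (snd q, snd p))"])
        (auto simp: splits_def add.assoc mult.assoc)
    also have "\<dots> = (\<Sum>p\<in>splits m. \<Sum>q\<in>splits (snd p).
          mv_coeff f (fst p) * (mv_coeff g (fst q) * mv_coeff h (snd q)))"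
      by (subst sum.Sigma) auto
    also have "\<dots> = mv_coeff (f * (g * h)) m"
      by (simp add: times_mvps_def case_prod_unfold sum_distrib_left)
    finally show "mv_coeff (f * g * h) m = mv_coeff (f * (g * h)) m" .
  qed
  show "f * g = g * f"
  proof (rule mvps_eqI)
    fix m
    show "mv_coeff (f * g) m = mv_coeff (g * f) m"
      unfolding times_mvps_def mv_coeff_Abs
      by (rule sum.reindex_bij_witness[of _ prod.swap prod.swap])
        (auto simp: splits_def add.commute mult.commute)
  qed
  show "1 * f = f"
  proof (rule mvps_eqI)
    fix m
    have "(\<Sum>p\<in>splits m. (if fst p = {#} then 1 else 0) * mv_coeff f (snd p)) =
        (\<Sum>p\<in>{({#} :: nat multiset, m)}. mv_coeff f (snd p))"
      by (rule sum.mono_neutral_cong_right[OF finite_splits]) (auto simp: splits_def)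
    then show "mv_coeff (1 * f) m = mv_coeff f m"
      by (simp add: times_mvps_def one_mvps_def case_prod_unfold)
  qed
  show "(f + g) * h = f * h + g * h"
    by (simp add: plus_mvps_def times_mvps_def case_prod_unfold distrib_right sum.distrib)
  show "(0::'a mvps) \<noteq> 1"
    by (auto simp: zero_mvps_def one_mvps_def Abs_mvps_inject fun_eq_iff)
qed (auto intro!: mvps_eqI
      simp: plus_mvps_def zero_mvps_def minus_mvps_def uminus_mvps_def algebra_simps)

end

definition mv_const :: "'a::zero \<Rightarrow> 'a mvps" where
  "mv_const c = Abs_mvps (\<lambda>m. if m = {#} then c else 0)"

definition mv_var :: "nat \<Rightarrow> 'a::zero_neq_one mvps" where
  "mv_var i = Abs_mvps (\<lambda>m. if m = {#i#} then 1 else 0)"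

text \<open>The series \<open>g(x\<^sub>i)\<close>, for a power series \<open>g\<close> in one variable.\<close>

definition mv_of_fps :: "nat \<Rightarrow> 'a::zero fps \<Rightarrow> 'a mvps" where
  "mv_of_fps i g = Abs_mvps (\<lambda>m. if set_mset m \<subseteq> {i} then fps_nth g (size m) else 0)"

text \<open>
  The sum of a family of which every monomial occurs in only finitely many members; a coefficient
  with infinitely many nonzero contributions would be set to \<open>0\<close>.
\<close>

definition mv_infsum :: "('i \<Rightarrow> 'a::comm_monoid_add mvps) \<Rightarrow> 'i set \<Rightarrow> 'a mvps" where
  "mv_infsum F I = Abs_mvps (\<lambda>m. \<Sum>i | i \<in> I \<and> mv_coeff (F i) m \<noteq> 0. mv_coeff (F i) m)"

text \<open>Coefficientwise limit of a sequence each of whose coefficients is eventually constant.\<close>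

definition mv_lim :: "(nat \<Rightarrow> 'a mvps) \<Rightarrow> 'a mvps" where
  "mv_lim F = Abs_mvps (\<lambda>m. THE c. eventually (\<lambda>N. mv_coeff (F N) m = c) sequentially)"

text \<open>
  Substitution \<open>f(s\<^sub>0, s\<^sub>1, s\<^sub>2, \<dots>)\<close>: each monomial of \<open>f\<close> is replaced by the corresponding product
  of the \<open>s\<^sub>i\<close>. The family is summable in the cases used below, by \<open>mv_subst_summable\<close>.
\<close>

definition mv_subst :: "(nat \<Rightarrow> 'a::comm_ring_1 mvps) \<Rightarrow> 'a mvps \<Rightarrow> 'a mvps" where
  "mv_subst s f = mv_infsum (\<lambda>m. mv_const (mv_coeff f m) * (\<Prod>i\<in>#m. s i)) UNIV"

definition hom_comp :: "nat \<Rightarrow> 'a::zero mvps \<Rightarrow> 'a mvps" where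
  "hom_comp d f = Abs_mvps (\<lambda>m. if size m = d then mv_coeff f m else 0)"

text \<open>
  \<open>f\<close> is the infinite linear combination \<open>\<Sum>\<lambda>\<in>I. c \<lambda> \<cdot> b \<lambda>\<close>, converging in each degree: in each
  degree only finitely many terms contribute, and they add up to the homogeneous component of \<open>f\<close>.
\<close>

definition is_inf_lincomb ::
  "'i set \<Rightarrow> ('i \<Rightarrow> 'a::comm_ring_1 mvps) \<Rightarrow> ('i \<Rightarrow> 'a) \<Rightarrow> 'a mvps \<Rightarrow> bool" where
  "is_inf_lincomb I b c f \<longleftrightarrow>
     (\<forall>d. finite {l \<in> I. hom_comp d (mv_const (c l) * b l) \<noteq> 0} \<and>
          hom_comp d f =
            (\<Sum>l | l \<in> I \<and> hom_comp d (mv_const (c l) * b l) \<noteq> 0.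
               hom_comp d (mv_const (c l) * b l)))"

text \<open>Coefficient families are pinned to \<open>0\<close> outside the index set, where they are irrelevant.\<close>

definition uniquely_expressible ::
  "'i set \<Rightarrow> ('i \<Rightarrow> 'a::comm_ring_1 mvps) \<Rightarrow> 'a mvps \<Rightarrow> bool" where
  "uniquely_expressible I b f \<longleftrightarrow>
     (\<exists>!c. (\<forall>l. l \<notin> I \<longrightarrow> c l = 0) \<and> is_inf_lincomb I b c f)"


section \<open>Partitions\<close>

text \<open>A partition is the multiset of its (positive) parts.\<close>

definition partitions :: "nat multiset set" where
  "partitions = {l. 0 \<notin># l}"

definition odd_partitions :: "nat multiset set" where
  "odd_partitions = {l \<in> partitions. \<forall>k\<in>#l. odd k}"

definition strict_partitions :: "nat multiset set" where
  "strict_partitions = {l \<in> partitions. \<forall>k\<in>#l. count l k = 1}"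

definition part_prod :: "(nat \<Rightarrow> 'a::comm_monoid_mult) \<Rightarrow> nat multiset \<Rightarrow> 'a" where
  "part_prod g l = (\<Prod>k\<in>#l. g k)"


section \<open>The ring \<open>G\<Gamma>\<close> and its distinguished elements\<close>

text \<open>\<open>\<rat>(\<beta>)\<close> is the field of fractions of \<open>\<rat>[\<beta>]\<close>.\<close>

type_synonym rat_beta = "rat poly fract"

definition beta :: rat_beta where
  "beta = Fract [:0, 1:] 1"

text \<open>The series \<open>-u / (1 + \<beta>u)\<close> and \<open>u / (1 + (\<beta>/2)u)\<close>.\<close>

definition fbar :: "rat_beta fps" where
  "fbar = - fps_X / (1 + fps_const beta * fps_X)"

definition fhalf :: "rat_beta fps" where
  "fhalf = fps_X / (1 + fps_const (beta / 2) * fps_X)"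

definition psum :: "nat \<Rightarrow> rat_beta mvps" where
  "psum n = mv_infsum (\<lambda>j. mv_var j ^ n) UNIV"

definition Lambda_hat :: "rat_beta mvps set" where
  "Lambda_hat = {f. \<exists>c. is_inf_lincomb partitions (part_prod psum) c f}"

text \<open>
  In \<open>f(t, bar t, x\<^sub>3, x\<^sub>4, \<dots>)\<close> the role of \<open>t\<close> is played by variable \<open>0\<close>; independence of \<open>t\<close> means
  that no monomial involving it survives.
\<close>

definition KQ_cancellation :: "rat_beta mvps \<Rightarrow> bool" where
  "KQ_cancellation f \<longleftrightarrow>
     (\<forall>m. 0 \<in># m \<longrightarrow>
        mv_coeff (mv_subst (\<lambda>i. if i = 1 then mv_of_fps 0 fbar else mv_var i) f) m = 0)"

definition GGamma :: "rat_beta mvps set" where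
  "GGamma = {f \<in> Lambda_hat. KQ_cancellation f}"

definition pbeta :: "nat \<Rightarrow> rat_beta mvps" where
  "pbeta n = mv_subst (\<lambda>i. mv_of_fps i fhalf) (psum n)"

text \<open>
  The factor \<open>(1 - bar x\<^sub>i z) / (1 - x\<^sub>i z)\<close>, a power series in \<open>z\<close> (\<^const>\<open>fps_X\<close>) over the power series in
  the \<open>x\<^sub>j\<close>. The coefficient ring is not a field, so division is replaced by multiplication
  with the power series inverse of \<open>1 - x\<^sub>i z\<close> (its second argument is the constant term).
\<close>

definition qfactor :: "nat \<Rightarrow> rat_beta mvps fps" where
  "qfactor i = (1 - fps_const (mv_of_fps i fbar) * fps_X) *
               fps_right_inverse (1 - fps_const (mv_var i) * fps_X) 1"

definition qbeta :: "nat \<Rightarrow> rat_beta mvps" where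
  "qbeta n = mv_lim (\<lambda>N. fps_nth (\<Prod>i<N. qfactor i) n)"

definition qbeta_bar :: "nat \<Rightarrow> rat_beta mvps" where
  "qbeta_bar n = mv_subst (\<lambda>i. mv_of_fps i fbar) (qbeta n)"


section \<open>Well-definedness of the infinite sums and of the infinite product\<close>

lemma mv_coeff_var: "mv_coeff (mv_var i) m = (if m = {#i#} then 1 else 0)"
  by (simp add: mv_var_def)

lemma mv_coeff_0 [simp]: "mv_coeff 0 m = 0"
  by (simp add: zero_mvps_def)

lemma mv_coeff_1: "mv_coeff 1 m = (if m = {#} then 1 else 0)"
  by (simp add: one_mvps_def)

lemma mv_coeff_diff [simp]: "mv_coeff (f - g) m = mv_coeff f m - mv_coeff g m"
  by (simp add: minus_mvps_def)

lemma mv_coeff_add [simp]: "mv_coeff (f + g) m = mv_coeff f m + mv_coeff g m"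
  by (simp add: plus_mvps_def)

lemma mv_coeff_mult: "mv_coeff (f * g) m = (\<Sum>(a, b)\<in>splits m. mv_coeff f a * mv_coeff g b)"
  by (simp add: times_mvps_def)

lemma mv_coeff_sum: "mv_coeff (sum F I) m = (\<Sum>i\<in>I. mv_coeff (F i) m)"
  by (induction I rule: infinite_finite_induct) simp_all

lemma mv_coeff_mult_nzE:
  assumes "mv_coeff (f * g) m \<noteq> 0"
  obtains a b where "m = a + b" "mv_coeff f a \<noteq> 0" "mv_coeff g b \<noteq> 0"
proof -
  have "\<exists>p\<in>splits m. mv_coeff f (fst p) * mv_coeff g (snd p) \<noteq> 0"
    using assms by (auto simp: mv_coeff_mult case_prod_unfold intro: ccontr dest: sum.not_neutral_contains_not_neutral)
  then obtain a b where "m = a + b" "mv_coeff f a * mv_coeff g b \<noteq> 0"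
    by (auto simp: splits_def)
  then show ?thesis using that by (metis mult_zero_left mult_zero_right)
qed

lemma mv_coeff_const_mult: "mv_coeff (mv_const c * f) m = c * mv_coeff f m"
proof -
  have "(\<Sum>p\<in>splits m. (if fst p = {#} then c else 0) * mv_coeff f (snd p)) =
        (\<Sum>p\<in>{({#} :: nat multiset, m)}. c * mv_coeff f (snd p))"
    by (rule sum.mono_neutral_cong_right[OF finite_splits]) (auto simp: splits_def)
  then show ?thesis by (simp add: mv_coeff_mult mv_const_def case_prod_unfold)
qed

lemma mv_coeff_prod_nz:
  assumes s: "\<And>i a. mv_coeff (s i) a \<noteq> 0 \<Longrightarrow> set_mset a = {r i}"
  assumes "mv_coeff (\<Prod>i\<in>#m'. s i) m \<noteq> (0::'a::comm_ring_1)"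
  shows "set_mset m = r ` set_mset m' \<and> size m' \<le> size m"
  using assms(2)
proof (induction m' arbitrary: m)
  case empty
  then show ?case by (auto simp: mv_coeff_1 split: if_splits)
next
  case (add i m')
  from add.prems obtain a b where ab: "m = a + b" "mv_coeff (s i) a \<noteq> 0"
    "mv_coeff (\<Prod>i\<in>#m'. s i) b \<noteq> 0" by (auto elim: mv_coeff_mult_nzE)
  from s[OF ab(2)] have "size a \<ge> 1" by (cases a) auto
  with add.IH[OF ab(3)] s[OF ab(2)] ab(1) show ?case by auto
qed

lemma mv_subst_summable:
  assumes s: "\<And>i a. mv_coeff (s i) a \<noteq> 0 \<Longrightarrow> set_mset a = {r i}"
    and r: "\<And>j. finite {i. r i = j}"
  shows "finite {m'. mv_coeff (mv_const (mv_coeff f m') * (\<Prod>i\<in>#m'. s i)) m \<noteq> (0::'a::comm_ring_1)}"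
proof (rule finite_subset)
  let ?A = "\<Union>j\<in>set_mset m. {i. r i = j}"
  show "{m'. mv_coeff (mv_const (mv_coeff f m') * (\<Prod>i\<in>#m'. s i)) m \<noteq> 0}
      \<subseteq> (\<Union>n\<le>size m. multisets_of_size ?A n)"
  proof
    fix m' assume "m' \<in> {m'. mv_coeff (mv_const (mv_coeff f m') * (\<Prod>i\<in>#m'. s i)) m \<noteq> 0}"
    then have "mv_coeff (\<Prod>i\<in>#m'. s i) m \<noteq> 0" by (auto simp: mv_coeff_const_mult)
    from mv_coeff_prod_nz[OF s this] show "m' \<in> (\<Union>n\<le>size m. multisets_of_size ?A n)"
      by (auto simp: multisets_of_size_def)
  qed
  show "finite (\<Union>n\<le>size m. multisets_of_size ?A n)" using r by auto
qed

lemma mv_of_fps_nz: "fps_nth g 0 = 0 \<Longrightarrow> mv_coeff (mv_of_fps i g) a \<noteq> 0 \<Longrightarrow> set_mset a = {i}"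
  by (cases "a = {#}") (auto simp: mv_of_fps_def subset_singleton_iff split: if_splits)

lemma mv_var_nz: "mv_coeff (mv_var i) a \<noteq> 0 \<Longrightarrow> set_mset a = {i}"
  by (auto simp: mv_var_def split: if_splits)

lemma fbar_nth_0 [simp]: "fps_nth fbar 0 = 0"
  by (simp add: fbar_def fps_divide_unit)

lemma fhalf_nth_0 [simp]: "fps_nth fhalf 0 = 0"
  by (simp add: fhalf_def fps_divide_unit)

lemma fbar_mult: "fbar * (1 + fps_const beta * fps_X) = - fps_X"
  by (simp add: fbar_def fps_divide_unit inverse_mult_eq_1 mult.assoc)

lemma KQ_subst_summable:
  "finite {m'. mv_coeff (mv_const (mv_coeff f m') *
     (\<Prod>i\<in>#m'. if i = 1 then mv_of_fps 0 fbar else mv_var i)) m \<noteq> 0}"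
proof (rule mv_subst_summable[where r = "\<lambda>i. if i = 1 then 0 else i"])
  show "set_mset a = {if i = 1 then 0 else i}"
    if "mv_coeff (if i = 1 then mv_of_fps 0 fbar else mv_var i) a \<noteq> 0" for i a
    using that by (auto dest: mv_of_fps_nz[rotated] mv_var_nz split: if_splits)
  show "finite {i. (if i = 1 then 0 else i) = j}" for j :: nat
    by (rule finite_subset[of _ "{1, j}"]) (auto split: if_splits)
qed

lemma fhalf_mult: "fhalf * (1 + fps_const (beta / 2) * fps_X) = fps_X"
  by (simp add: fhalf_def fps_divide_unit inverse_mult_eq_1 mult.assoc)

lemma variablewise_subst_summable:
  "fps_nth g 0 = 0 \<Longrightarrow>
   finite {m'. mv_coeff (mv_const (mv_coeff f m') * (\<Prod>i\<in>#m'. mv_of_fps i g)) m \<noteq>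
     (0::'a::comm_ring_1)}"
  by (rule mv_subst_summable[where r = "\<lambda>i. i"]) (auto dest: mv_of_fps_nz[rotated])

lemma qfactor_inverse:
  "fps_right_inverse (1 - fps_const (mv_var i :: rat_beta mvps) * fps_X) 1 *
   (1 - fps_const (mv_var i) * fps_X) = 1"
  by (subst mult.commute, rule fps_right_inverse) simp

lemma mv_var_power: "mv_coeff (mv_var j ^ n) m = (if m = replicate_mset n j then 1 else (0::'a::comm_ring_1))"
proof (induction n arbitrary: m)
  case 0 show ?case by (simp add: mv_coeff_1)
next
  case (Suc n)
  have "mv_coeff (mv_var j ^ Suc n) m = (\<Sum>p\<in>splits m. (if p = ({#j#}, replicate_mset n j) then 1 else (0::'a)))"
    unfolding power_Suc mv_coeff_mult case_prod_unfold
    by (intro sum.cong) (auto simp: Suc mv_coeff_var prod_eq_iff)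
  also have "\<dots> = (if m = replicate_mset (Suc n) j then 1 else 0)"
    by (subst sum.delta[OF finite_splits]) (auto simp: splits_def)
  finally show ?case .
qed

lemma psum_summable: "n > 0 \<Longrightarrow> finite {j. mv_coeff (mv_var j ^ n :: rat_beta mvps) m \<noteq> 0}"
  by (rule finite_subset[of _ "set_mset m"]) (auto simp: mv_var_power split: if_splits)

lemma fps_right_inverse_geom:
  "fps_right_inverse (1 - fps_const (x :: 'a::comm_ring_1) * fps_X) 1 = Abs_fps (\<lambda>n. x ^ n)"
proof -
  let ?f = "1 - fps_const x * fps_X" and ?g = "Abs_fps (\<lambda>n. x ^ n)"
  have 1: "?f * ?g = 1"
  proof (rule fps_ext)
    fix n show "fps_nth (?f * ?g) n = fps_nth 1 n"
      by (cases n) (simp_all add: left_diff_distrib mult.assoc)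
  qed
  have 2: "fps_right_inverse ?f 1 * ?f = 1"
    by (subst mult.commute, rule fps_right_inverse) simp
  have "fps_right_inverse ?f 1 * (?f * ?g) = ?g"
  by (simp add: 2 mult.assoc[symmetric])
  then show ?thesis by (simp add: 1)
qed

lemma qfactor_nth_nz:
  assumes "mv_coeff (fps_nth (qfactor i) n) a \<noteq> 0"
  shows "set_mset a \<subseteq> {i} \<and> (a = {#} \<longrightarrow> n = 0)"
proof (cases n)
  case 0
  then show ?thesis using assms by (auto simp: qfactor_def mv_coeff_1 split: if_splits)
next
  case (Suc k)
  have *: "fps_nth (qfactor i) n = mv_var i ^ n - mv_of_fps i fbar * mv_var i ^ k"
    by (simp add: qfactor_def fps_right_inverse_geom Suc left_diff_distrib mult.assoc)
  consider "mv_coeff (mv_var i ^ n :: rat_beta mvps) a \<noteq> 0"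
    | "mv_coeff (mv_of_fps i fbar * mv_var i ^ k) a \<noteq> 0"
    using assms unfolding * by (cases "mv_coeff (mv_var i ^ n :: rat_beta mvps) a = 0") auto
  then show ?thesis
  proof cases
    case 1 then show ?thesis by (auto simp: mv_var_power split: if_splits)
  next
    case 2
    then obtain b c where "a = b + c" "mv_coeff (mv_of_fps i fbar) b \<noteq> 0" "mv_coeff (mv_var i ^ k :: rat_beta mvps) c \<noteq> 0"
      by (elim mv_coeff_mult_nzE)
    then show ?thesis using mv_of_fps_nz[of fbar i b] by (auto simp: mv_var_power split: if_splits)
  qed
qed

lemma qbeta_stable:
  assumes "\<And>j. j \<in># m \<Longrightarrow> j < N" "N \<le> M"
  shows "mv_coeff (fps_nth (\<Prod>i<M. qfactor i) n) m = mv_coeff (fps_nth (\<Prod>i<N. qfactor i) n) m"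
  using assms(2)
proof (induction M rule: dec_induct)
  case base show ?case ..
next
  case (step M)
  let ?P = "\<Prod>i<M. qfactor i"
  have z: "mv_coeff (fps_nth ?P k * fps_nth (qfactor M) (n - k)) m = 0" if "k < n" for k
  proof (rule ccontr)
    assume "\<not> ?thesis"
    then obtain a b where "m = a + b" "mv_coeff (fps_nth (qfactor M) (n - k)) b \<noteq> 0"
      by (elim mv_coeff_mult_nzE)
    with qfactor_nth_nz[OF this(2)] that assms(1) step(1) show False
      by (cases b) force+
  qed
  have q0: "fps_nth (qfactor M) 0 = 1"
  by (simp add: qfactor_def)
  have "mv_coeff (fps_nth (\<Prod>i<Suc M. qfactor i) n) m =
      (\<Sum>k=0..n. mv_coeff (fps_nth ?P k * fps_nth (qfactor M) (n - k)) m)"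
    by (simp only: prod.lessThan_Suc fps_mult_nth mv_coeff_sum)
  also have "\<dots> = (\<Sum>k\<in>{n}. mv_coeff (fps_nth ?P k * fps_nth (qfactor M) (n - k)) m)"
    by (rule sum.mono_neutral_right) (auto intro!: z)
  finally show ?case using step.IH by (simp add: q0)
qed

lemma qbeta_convergent:
  "eventually (\<lambda>N. mv_coeff (fps_nth (\<Prod>i<N. qfactor i) n) m = mv_coeff (qbeta n) m) sequentially"
proof -
  obtain N where N: "\<And>j. j \<in># m \<Longrightarrow> j < N"
    using finite_nat_set_iff_bounded[of "set_mset m"] by auto
  let ?c = "mv_coeff (fps_nth (\<Prod>i<N. qfactor i) n) m"
  have ev: "eventually (\<lambda>M. mv_coeff (fps_nth (\<Prod>i<M. qfactor i) n) m = ?c) sequentially"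
    using qbeta_stable[of m N, OF N] unfolding eventually_sequentially by blast
  have "(THE c. eventually (\<lambda>M. mv_coeff (fps_nth (\<Prod>i<M. qfactor i) n) m = c) sequentially) = ?c"
  proof (rule the_equality)
    fix c assume "eventually (\<lambda>M. mv_coeff (fps_nth (\<Prod>i<M. qfactor i) n) m = c) sequentially"
    with ev have "eventually (\<lambda>M::nat. c = ?c) sequentially" by eventually_elim simp
    then show "c = ?c" by simp
  qed (rule ev)
  then show ?thesis using ev by (simp add: qbeta_def mv_lim_def)
qed

end

theory Submission
  imports Defs "HOL-Library.Nat_Bijection"
begin

text \<open>
  Everything is reduced to lowest homogeneous components. If \<open>f\<close> has the cancellation property and no
  component below degree \<open>d\<close>, then its component \<open>f\<^sub>d\<close> is a symmetric function for which
  \<open>f\<^sub>d(t, -t, x\<^sub>3, \<dots>)\<close> is independent of \<open>t\<close>, hence a combination of the \<open>p\<^sub>\<lambda>\<close> with \<open>\<lambda>\<close> odd. So a family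
  \<open>b\<^sub>\<lambda>\<close> with the cancellation property has unique expansions once its lowest components form a
  basis of the span of these \<open>p\<^sub>\<lambda>\<close> in each degree. For \<open>p\<^sup>\<beta>\<close> the lowest components are the \<open>p\<^sub>\<lambda>\<close>
  themselves. For \<open>q\<^sup>\<beta>\<close> and its conjugate, logarithmic differentiation of the generating product gives a
  Newton recursion in the power sums \<open>\<Sum>\<^sub>j (x\<^sub>j\<^sup>k - bar x\<^sub>j\<^sup>k)\<close>, which yields the cancellation property and,
  in lowest degree, Schur's relation \<open>Q(z) Q(-z) = 1\<close>; by means of this relation the products over odd
  and over strict partitions both span, and Glaisher's injection of the strict partitions into the
  odd ones shows that neither spanning set is too large.
\<close>


section \<open>Power series in infinitely many variables\<close>

lemma mv_const_0 [simp]: "mv_const 0 = 0"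
  by (rule mvps_eqI) (simp add: mv_const_def)

lemma mv_const_1 [simp]: "mv_const 1 = 1"
  by (rule mvps_eqI) (simp add: mv_const_def mv_coeff_1)

lemma mv_const_add: "mv_const (a + b) = mv_const a + mv_const (b :: 'a::comm_ring_1)"
  by (rule mvps_eqI) (simp add: mv_const_def)

lemma mv_const_uminus: "mv_const (- a) = - mv_const (a :: 'a::comm_ring_1)"
  by (rule mvps_eqI) (simp add: mv_const_def uminus_mvps_def)

lemma mv_const_mult: "mv_const (a * b) = mv_const a * mv_const (b :: 'a::comm_ring_1)"
  by (rule mvps_eqI) (simp add: mv_coeff_const_mult, simp add: mv_const_def)

lemma mv_const_of_nat: "mv_const (of_nat n) = (of_nat n :: 'a::comm_ring_1 mvps)"
  by (induction n) (simp_all add: mv_const_add)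

lemma mv_coeff_uminus [simp]: "mv_coeff (- f) m = - mv_coeff f m"
  by (simp add: uminus_mvps_def)

lemma mv_coeff_of_nat_mult: "mv_coeff (of_nat n * f) m = of_nat n * mv_coeff f m"
  by (simp add: mv_const_of_nat [symmetric] mv_coeff_const_mult)

text \<open>Scalars act through constant series. Spans, independence and the final dimension count
  all refer to this structure.\<close>

interpretation mvs: vector_space "\<lambda>c (f :: 'a::field mvps). mv_const c * f"
  by unfold_locales (simp_all add: mv_const_add mv_const_mult algebra_simps)

text \<open>Only divisors of the monomial enter, so at a fixed monomial an infinite product can be
  exchanged for a finite truncation.\<close>

lemma mv_coeff_mult_cong:
  assumes "\<And>a. a \<subseteq># m \<Longrightarrow> mv_coeff f a = mv_coeff f' a"
    and "\<And>a. a \<subseteq># m \<Longrightarrow> mv_coeff g a = mv_coeff g' a"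
  shows "mv_coeff (f * g) m = mv_coeff (f' * g') m"
  unfolding mv_coeff_mult
  by (rule sum.cong) (auto simp: splits_def assms)

lemma mv_coeff_mult_nonneg:
  fixes f g :: "'a::linordered_idom mvps"
  assumes "\<And>a. mv_coeff f a \<ge> 0" "\<And>a. mv_coeff g a \<ge> 0"
  shows "mv_coeff (f * g) m \<ge> 0"
  unfolding mv_coeff_mult by (rule sum_nonneg) (auto simp: assms)

text \<open>Nonnegative contributions cannot cancel, so a single positive one suffices. It is
  applied over the ordered field \<open>rat_beta\<close>.\<close>

lemma mv_coeff_mult_pos:
  fixes f g :: "'a::linordered_idom mvps"
  assumes "\<And>a. mv_coeff f a \<ge> 0" "\<And>a. mv_coeff g a \<ge> 0"
    and "mv_coeff f a > 0" "mv_coeff g b > 0"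
  shows "mv_coeff (f * g) (a + b) > 0"
  unfolding mv_coeff_mult
  by (rule sum_pos2 [OF finite_splits, where i = "(a, b)"]) (use assms in \<open>auto simp: splits_def\<close>)

section \<open>Homogeneous components and lowest degrees\<close>

lemma mv_coeff_hom_comp [simp]: "mv_coeff (hom_comp d f) m = (if size m = d then mv_coeff f m else 0)"
  by (simp add: hom_comp_def)

lemma hom_comp_0 [simp]: "hom_comp d 0 = 0"
  by (rule mvps_eqI) simp

lemma hom_comp_add: "hom_comp d (f + g) = hom_comp d f + hom_comp d (g :: 'a::comm_ring_1 mvps)"
  by (rule mvps_eqI) simp

lemma hom_comp_diff: "hom_comp d (f - g) = hom_comp d f - hom_comp d (g :: 'a::comm_ring_1 mvps)"
  by (rule mvps_eqI) simp

lemma hom_comp_const_mult: "hom_comp d (mv_const c * f) = mv_const c * hom_comp d f"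
  by (rule mvps_eqI) (simp add: mv_coeff_const_mult)

lemma hom_comp_of_nat_mult: "hom_comp d (of_nat n * f) = of_nat n * hom_comp d f"
  by (rule mvps_eqI) (simp add: mv_coeff_of_nat_mult)

lemma hom_comp_sum: "hom_comp d (sum F A) = (\<Sum>i\<in>A. hom_comp d (F i :: 'a::comm_ring_1 mvps))"
  by (rule mvps_eqI) (simp add: mv_coeff_sum)

lemma hom_comp_1: "hom_comp d (1 :: 'a::comm_ring_1 mvps) = (if d = 0 then 1 else 0)"
  by (rule mvps_eqI) (simp add: mv_coeff_1)

lemma hom_comp_mult:
  "hom_comp d (f * g) = (\<Sum>i\<le>d. hom_comp i f * hom_comp (d - i) (g :: 'a::comm_ring_1 mvps))"
proof (rule mvps_eqI)
  fix m
  have "(\<Sum>i\<le>d. mv_coeff (hom_comp i f * hom_comp (d - i) g) m) =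
      (\<Sum>p\<in>splits m. \<Sum>i\<le>d. mv_coeff (hom_comp i f) (fst p) * mv_coeff (hom_comp (d - i) g) (snd p))"
    unfolding mv_coeff_mult case_prod_unfold by (rule sum.swap)
  also have "\<dots> = (\<Sum>p\<in>splits m. if size m = d then mv_coeff f (fst p) * mv_coeff g (snd p) else 0)"
  proof (rule sum.cong [OF refl])
    fix p assume "p \<in> splits m"
    then have sz: "size m = size (fst p) + size (snd p)" by (auto simp: splits_def)
    have "(\<Sum>i\<le>d. mv_coeff (hom_comp i f) (fst p) * mv_coeff (hom_comp (d - i) g) (snd p)) =
        (\<Sum>i\<le>d. if i = size (fst p) then (if size m = d then mv_coeff f (fst p) * mv_coeff g (snd p) else 0) else 0)"
      by (rule sum.cong) (use sz in auto)
    also have "\<dots> = (if size m = d then mv_coeff f (fst p) * mv_coeff g (snd p) else 0)"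
      by (subst sum.delta) (use sz in auto)
    finally show "(\<Sum>i\<le>d. mv_coeff (hom_comp i f) (fst p) * mv_coeff (hom_comp (d - i) g) (snd p)) = \<dots>" .
  qed
  also have "\<dots> = mv_coeff (hom_comp d (f * g)) m"
    by (simp add: mv_coeff_mult case_prod_unfold)
  finally show "mv_coeff (hom_comp d (f * g)) m =
      mv_coeff (\<Sum>i\<le>d. hom_comp i f * hom_comp (d - i) g) m"
    by (simp add: mv_coeff_sum)
qed

text \<open>A lower bound for the order instead of the exact order: it survives sums, and zero
  satisfies every bound.\<close>

definition vanishes_below :: "nat \<Rightarrow> 'a::zero mvps \<Rightarrow> bool" where
  "vanishes_below n f \<longleftrightarrow> (\<forall>m. size m < n \<longrightarrow> mv_coeff f m = 0)"

lemma vanishes_below_0 [simp]: "vanishes_below 0 f"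
  by (simp add: vanishes_below_def)

lemma hom_comp_eq_0: "vanishes_below n f \<Longrightarrow> d < n \<Longrightarrow> hom_comp d f = 0"
  by (rule mvps_eqI) (auto simp: vanishes_below_def)

lemma vanishes_below_mult:
  assumes "vanishes_below a f" "vanishes_below b (g :: 'a::comm_ring_1 mvps)"
  shows "vanishes_below (a + b) (f * g)"
  unfolding vanishes_below_def
proof (intro allI impI, rule ccontr)
  fix m assume size: "size m < a + b" and "mv_coeff (f * g) m \<noteq> 0"
  then obtain m1 m2 where m: "m = m1 + m2" and nz: "mv_coeff f m1 \<noteq> 0" "mv_coeff g m2 \<noteq> 0"
    by (elim mv_coeff_mult_nzE)
  have "a \<le> size m1" "b \<le> size m2"
    using nz assms by (auto simp: vanishes_below_def intro: leI)
  with m size show False by simp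
qed

lemma vanishes_below_sum:
  "(\<And>i. i \<in> A \<Longrightarrow> vanishes_below n (F i)) \<Longrightarrow> vanishes_below n (sum F A :: 'a::comm_ring_1 mvps)"
  by (simp add: vanishes_below_def mv_coeff_sum)

lemma vanishes_below_const_mult:
  "vanishes_below n f \<Longrightarrow> vanishes_below n (mv_const c * f)"
  by (simp add: vanishes_below_def mv_coeff_const_mult)

text \<open>In the convolution, every index other than \<open>a\<close> pushes one of the two
  factors below its bound.\<close>

lemma hom_comp_mult_lead:
  assumes "vanishes_below a f" "vanishes_below b (g :: 'a::comm_ring_1 mvps)"
  shows "hom_comp (a + b) (f * g) = hom_comp a f * hom_comp b g"
proof -
  have "hom_comp (a + b) (f * g) = (\<Sum>i\<le>a + b. hom_comp i f * hom_comp (a + b - i) g)"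
    by (rule hom_comp_mult)
  also have "\<dots> = (\<Sum>i\<in>{a}. hom_comp i f * hom_comp (a + b - i) g)"
  proof (rule sum.mono_neutral_right)
    show "\<forall>i\<in>{..a + b} - {a}. hom_comp i f * hom_comp (a + b - i) g = 0"
    proof
      fix i assume "i \<in> {..a + b} - {a}"
      then consider "i < a" | "a + b - i < b" by force
      then show "hom_comp i f * hom_comp (a + b - i) g = 0"
        by cases (simp_all add: hom_comp_eq_0 [OF assms(1)] hom_comp_eq_0 [OF assms(2)])
    qed
  qed auto
  finally show ?thesis by simp
qed

section \<open>Products over the parts of a partition\<close>

lemma part_prod_empty [simp]: "part_prod g {#} = 1"
  by (simp add: part_prod_def)

lemma part_prod_add_mset [simp]: "part_prod g (add_mset k l) = g k * part_prod g l"
  by (simp add: part_prod_def)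

lemma part_prod_union: "part_prod g (l + l') = part_prod g l * part_prod g l'"
  by (simp add: part_prod_def)

lemma part_prod_cong: "(\<And>k. k \<in># l \<Longrightarrow> g k = g' k) \<Longrightarrow> part_prod g l = part_prod g' l"
  by (induction l) simp_all

lemma vanishes_below_part_prod:
  assumes "\<And>k. k \<in># l \<Longrightarrow> vanishes_below k (g k :: 'a::comm_ring_1 mvps)"
  shows "vanishes_below (sum_mset l) (part_prod g l)"
  using assms by (induction l) (simp_all add: vanishes_below_mult)

lemma hom_comp_part_prod:
  assumes "\<And>k. k \<in># l \<Longrightarrow> vanishes_below k (g k :: 'a::comm_ring_1 mvps)"
  shows "hom_comp (sum_mset l) (part_prod g l) = part_prod (\<lambda>k. hom_comp k (g k)) l"
  using assms
  by (induction l) (simp_all add: hom_comp_1 hom_comp_mult_lead vanishes_below_part_prod)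


section \<open>Series in one of the variables and their symmetrizations\<close>

lemma set_mset_subset_singletonE:
  assumes "set_mset m \<subseteq> {i}"
  obtains n where "m = replicate_mset n i"
proof
  show "m = replicate_mset (size m) i"
    using assms by (induction m) auto
qed

lemma mv_coeff_mv_of_fps:
  "mv_coeff (mv_of_fps i g) m = (if set_mset m \<subseteq> {i} then fps_nth g (size m) else 0)"
  by (simp add: mv_of_fps_def)

lemma splits_replicate_mset:
  "splits (replicate_mset n i) = (\<lambda>k. (replicate_mset k i, replicate_mset (n - k) i)) ` {0..n}"
proof (intro equalityI subsetI)
  fix p assume "p \<in> splits (replicate_mset n i)"
  then have sum: "fst p + snd p = replicate_mset n i" by (auto simp: splits_def)
  then have "set_mset (fst p) \<union> set_mset (snd p) \<subseteq> {i}"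
    by (metis set_mset_replicate_mset_subset set_mset_union empty_subsetI subset_refl)
  then obtain a b where ab: "fst p = replicate_mset a i" "snd p = replicate_mset b i"
    by (auto elim!: set_mset_subset_singletonE)
  have "a + b = n" using arg_cong [OF sum, of size] ab by simp
  with ab show "p \<in> (\<lambda>k. (replicate_mset k i, replicate_mset (n - k) i)) ` {0..n}"
    by (auto simp: image_iff prod_eq_iff intro!: bexI [of _ a])
next
  fix p assume "p \<in> (\<lambda>k. (replicate_mset k i, replicate_mset (n - k) i)) ` {0..n}"
  then show "p \<in> splits (replicate_mset n i)"
    by (auto simp: splits_def multiset_eq_iff)
qed

text \<open>A power of one variable splits only into powers of that variable, so the multivariate
  product reduces to the Cauchy product.\<close>

lemma mv_of_fps_mult: "mv_of_fps i (f * g) = mv_of_fps i f * mv_of_fps i (g :: 'a::comm_ring_1 fps)"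
proof (rule mvps_eqI)
  fix m
  show "mv_coeff (mv_of_fps i (f * g)) m = mv_coeff (mv_of_fps i f * mv_of_fps i g) m"
  proof (cases "set_mset m \<subseteq> {i}")
    case True
    then obtain n where m: "m = replicate_mset n i" by (rule set_mset_subset_singletonE)
    have "inj_on (\<lambda>k. (replicate_mset k i, replicate_mset (n - k) i)) {0..n}"
      by (rule inj_on_inverseI [of _ "\<lambda>p. size (fst p)"]) simp
    moreover have "set_mset (replicate_mset k i) \<subseteq> {i}" for k by simp
    ultimately show ?thesis
      by (simp add: m mv_coeff_mult splits_replicate_mset sum.reindex mv_coeff_mv_of_fps
          fps_mult_nth del: set_mset_replicate_mset_subset)
  next
    case False
    have "mv_coeff (mv_of_fps i f * mv_of_fps i g) m = 0"
    proof (rule ccontr)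
      assume "mv_coeff (mv_of_fps i f * mv_of_fps i g) m \<noteq> 0"
      then show False
        using False by (elim mv_coeff_mult_nzE) (auto simp: mv_coeff_mv_of_fps split: if_splits)
    qed
    then show ?thesis using False by (simp add: mv_coeff_mv_of_fps)
  qed
qed

lemma mv_of_fps_1: "mv_of_fps i 1 = (1 :: 'a::comm_ring_1 mvps)"
  by (rule mvps_eqI) (auto simp: mv_coeff_mv_of_fps mv_coeff_1)

lemma mv_of_fps_power: "mv_of_fps i (g ^ k) = (mv_of_fps i g :: 'a::comm_ring_1 mvps) ^ k"
  by (induction k) (simp_all add: mv_of_fps_1 mv_of_fps_mult)

lemma mv_of_fps_diff: "mv_of_fps i (f - g) = mv_of_fps i f - mv_of_fps i (g :: 'a::comm_ring_1 fps)"
  by (rule mvps_eqI) (simp add: mv_coeff_mv_of_fps)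

lemma mv_var_conv_mv_of_fps: "mv_var i = (mv_of_fps i fps_X :: 'a::comm_ring_1 mvps)"
proof (rule mvps_eqI)
  fix m
  have "(m = {#i#}) = (set_mset m \<subseteq> {i} \<and> size m = 1)"
    by (auto elim!: set_mset_subset_singletonE)
  then show "mv_coeff (mv_var i) m = mv_coeff (mv_of_fps i fps_X :: 'a mvps) m"
    by (simp add: mv_coeff_var mv_coeff_mv_of_fps fps_X_def)
qed

text \<open>The series \<open>g(x\<^sub>0) + g(x\<^sub>1) + \<dots>\<close>, without the infinitely many constant terms of its summands.\<close>

definition fps_psum :: "'a::zero fps \<Rightarrow> 'a mvps" where
  "fps_psum g = Abs_mvps (\<lambda>m. if card (set_mset m) = 1 then fps_nth g (size m) else 0)"

lemma mv_coeff_fps_psum: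
  "mv_coeff (fps_psum g) m = (if card (set_mset m) = 1 then fps_nth g (size m) else 0)"
  by (simp add: fps_psum_def)

lemma psum_conv_fps_psum:
  assumes "n > 0"
  shows "psum n = fps_psum (fps_X ^ n)"
proof (rule mvps_eqI)
  fix m
  have "mv_coeff (psum n) m = (\<Sum>j | m = replicate_mset n j. 1)"
    by (simp add: psum_def mv_infsum_def mv_var_power)
  also have "\<dots> = mv_coeff (fps_psum (fps_X ^ n)) m"
  proof (cases "\<exists>j. m = replicate_mset n j")
    case True
    then obtain j where "m = replicate_mset n j" by blast
    moreover from this have "{j'. m = replicate_mset n j'} = {j}"
      using assms by (auto simp: multiset_eq_iff)
    ultimately show ?thesis using assms by (simp add: mv_coeff_fps_psum)
  next
    case False
    have "card (set_mset m) = 1 \<Longrightarrow> size m \<noteq> n"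
      using False by (auto simp: card_1_singleton_iff elim!: set_mset_subset_singletonE [OF equalityD1])
    with False show ?thesis by (auto simp: mv_coeff_fps_psum fps_X_power_nth)
  qed
  finally show "mv_coeff (psum n) m = mv_coeff (fps_psum (fps_X ^ n)) m" .
qed

lemma hom_comp_fps_psum:
  assumes "n > 0"
  shows "hom_comp n (fps_psum g) = mv_const (fps_nth g n) * psum n"
  by (rule mvps_eqI)
    (use assms in \<open>simp add: psum_conv_fps_psum mv_coeff_const_mult mv_coeff_fps_psum fps_X_power_nth\<close>)

lemma hom_comp_0_fps_psum: "hom_comp 0 (fps_psum g :: 'a::comm_ring_1 mvps) = 0"
  by (rule mvps_eqI) (simp add: mv_coeff_fps_psum)

lemma vanishes_below_fps_psum:
  "(\<And>k. k < n \<Longrightarrow> fps_nth g k = 0) \<Longrightarrow> vanishes_below n (fps_psum g)"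
  by (simp add: vanishes_below_def mv_coeff_fps_psum)


section \<open>Substitution\<close>

text \<open>Each x_i is replaced by \<open>h i\<close> in the variable \<open>r i\<close>. This
  covers both the cancellation substitution and the same series in every variable. Zero constant
  terms and finite fibres leave finitely many contributions to each coefficient.\<close>

locale variable_subst =
  fixes r :: "nat \<Rightarrow> nat" and h :: "nat \<Rightarrow> 'a::field fps"
  assumes h_nth_0 [simp]: "\<And>i. fps_nth (h i) 0 = 0"
    and finite_fibre: "\<And>j. finite {i. r i = j}"
begin

definition s :: "nat \<Rightarrow> 'a mvps" where
  "s i = mv_of_fps (r i) (h i)"

text \<open>The monomials whose images can contribute to the coefficient at \<open>m\<close>.\<close>

definition preds :: "nat multiset \<Rightarrow> nat multiset set" where
  "preds m = (\<Union>n\<le>size m. multisets_of_size (r -` set_mset m) n)"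

lemma in_preds_iff: "m' \<in> preds m \<longleftrightarrow> (\<forall>i\<in>#m'. r i \<in># m) \<and> size m' \<le> size m"
  by (auto simp: preds_def multisets_of_size_def)

lemma finite_vimage_set_mset [simp]: "finite (r -` set_mset m)"
proof -
  have "r -` set_mset m = (\<Union>j\<in>set_mset m. {i. r i = j})" by auto
  then show ?thesis by (simp add: finite_fibre)
qed

lemma finite_preds [simp]: "finite (preds m)"
  unfolding preds_def by (intro finite_UN_I finite_multisets_of_size) auto

lemma preds_add: "m \<in> preds m' \<longleftrightarrow> a \<in> preds m' \<and> b \<in> preds m' \<and> size m \<le> size m'" if "m = a + b"
  using that by (auto simp: in_preds_iff)

lemma preds_mono: "a \<subseteq># m \<Longrightarrow> preds a \<subseteq> preds m"
  using size_mset_mono [of a m] mset_subset_eqD [of a m]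
  by (fastforce simp: in_preds_iff)

lemma mv_coeff_prod_s_nz: "mv_coeff (\<Prod>i\<in>#m'. s i) m \<noteq> 0 \<Longrightarrow> m' \<in> preds m"
proof -
  assume "mv_coeff (\<Prod>i\<in>#m'. s i) m \<noteq> 0"
  then have "set_mset m = r ` set_mset m' \<and> size m' \<le> size m"
    by (rule mv_coeff_prod_nz [rotated]) (auto simp: s_def dest: mv_of_fps_nz [rotated])
  then show ?thesis by (auto simp: in_preds_iff)
qed

text \<open>The index set may be larger than \<open>preds m\<close>, so that coefficients at all
  divisors of a monomial can be computed over one common set.\<close>

lemma mv_coeff_subst:
  assumes "finite D" "preds m \<subseteq> D"
  shows "mv_coeff (mv_subst s f) m = (\<Sum>m'\<in>D. mv_coeff f m' * mv_coeff (\<Prod>i\<in>#m'. s i) m)"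
  unfolding mv_subst_def mv_infsum_def mv_coeff_Abs mv_coeff_const_mult
  by (rule sum.mono_neutral_left) (use assms mv_coeff_prod_s_nz [of _ m] in auto)

lemmas mv_coeff_subst_preds = mv_coeff_subst [OF finite_preds subset_refl]

lemma mv_coeff_subst_cong:
  assumes "\<And>m'. m' \<in> preds m \<Longrightarrow> mv_coeff f m' = mv_coeff g m'"
  shows "mv_coeff (mv_subst s f) m = mv_coeff (mv_subst s g) m"
  unfolding mv_coeff_subst_preds by (rule sum.cong) (simp_all add: assms)

lemma subst_0: "mv_subst s 0 = 0"
  by (rule mvps_eqI) (simp add: mv_coeff_subst_preds)

lemma subst_1: "mv_subst s 1 = 1"
proof (rule mvps_eqI)
  fix m
  have "mv_coeff (mv_subst s 1) m = (\<Sum>m'\<in>preds m. if m' = {#} then mv_coeff 1 m else 0)"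
    unfolding mv_coeff_subst_preds by (rule sum.cong) (auto simp: mv_coeff_1)
  also have "\<dots> = mv_coeff 1 m"
    by (simp add: in_preds_iff)
  finally show "mv_coeff (mv_subst s 1) m = mv_coeff 1 m" .
qed

lemma subst_add: "mv_subst s (f + g) = mv_subst s f + mv_subst s g"
  by (rule mvps_eqI) (simp add: mv_coeff_subst_preds algebra_simps sum.distrib)

lemma subst_const_mult: "mv_subst s (mv_const c * f) = mv_const c * mv_subst s f"
  by (rule mvps_eqI) (simp add: mv_coeff_subst_preds mv_coeff_const_mult sum_distrib_left mult.assoc)

lemma subst_sum: "mv_subst s (sum F A) = (\<Sum>i\<in>A. mv_subst s (F i))"
  by (induction A rule: infinite_finite_induct) (simp_all add: subst_0 subst_add)

text \<open>Both sides become a sum over pairs of source monomials and a splitting of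
  \<open>m\<close>, with all source monomials confined to the finite set
  \<open>preds m\<close>.\<close>

lemma subst_mult: "mv_subst s (f * g) = mv_subst s f * mv_subst s g"
proof (rule mvps_eqI)
  fix m
  define E where "E m' m = mv_coeff (\<Prod>i\<in>#m'. s i) m" for m' m
  let ?D = "preds m"
  have "mv_coeff (mv_subst s (f * g)) m =
      (\<Sum>m'\<in>?D. \<Sum>p\<in>splits m'. mv_coeff f (fst p) * mv_coeff g (snd p) * E (fst p + snd p) m)"
    unfolding mv_coeff_subst_preds mv_coeff_mult E_def [symmetric] case_prod_unfold sum_distrib_right
    by (intro sum.cong) (auto simp: splits_def)
  also have "\<dots> = (\<Sum>q\<in>(SIGMA m':?D. splits m').
      mv_coeff f (fst (snd q)) * mv_coeff g (snd (snd q)) * E (fst (snd q) + snd (snd q)) m)"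
    by (subst sum.Sigma) (auto simp: case_prod_unfold)
  also have "\<dots> = (\<Sum>p\<in>?D \<times> ?D. mv_coeff f (fst p) * mv_coeff g (snd p) * E (fst p + snd p) m)"
  \<comment> \<open>A splitting determines the monomial it splits. Pairs whose product leaves
    \<open>?D\<close> are extra, but have weight zero.\<close>
  proof (rule sum.reindex_bij_witness_not_neutral [where
        i = "\<lambda>p. (fst p + snd p, p)" and j = snd and
        S' = "{}" and T' = "{p \<in> ?D \<times> ?D. fst p + snd p \<notin> ?D}"])
    show "mv_coeff f (fst b) * mv_coeff g (snd b) * E (fst b + snd b) m = 0"
      if "b \<in> {p \<in> ?D \<times> ?D. fst p + snd p \<notin> ?D}" for b
      using that mv_coeff_prod_s_nz [of "fst b + snd b" m] by (auto simp: E_def)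
  qed (auto simp: splits_def preds_add [OF refl] in_preds_iff)
  also have "\<dots> = (\<Sum>p\<in>?D \<times> ?D. \<Sum>q\<in>splits m.
      (mv_coeff f (fst p) * E (fst p) (fst q)) * (mv_coeff g (snd p) * E (snd p) (snd q)))"
  proof (rule sum.cong [OF refl])
    fix p
    have "E (fst p + snd p) m = (\<Sum>q\<in>splits m. E (fst p) (fst q) * E (snd p) (snd q))"
      by (simp add: E_def mv_coeff_mult case_prod_unfold)
    then show "mv_coeff f (fst p) * mv_coeff g (snd p) * E (fst p + snd p) m = (\<Sum>q\<in>splits m.
        (mv_coeff f (fst p) * E (fst p) (fst q)) * (mv_coeff g (snd p) * E (snd p) (snd q)))"
      by (simp only: sum_distrib_left mult.assoc mult.left_commute)
  qed
  also have "\<dots> = (\<Sum>q\<in>splits m. \<Sum>p\<in>?D \<times> ?D.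
      (mv_coeff f (fst p) * E (fst p) (fst q)) * (mv_coeff g (snd p) * E (snd p) (snd q)))"
    by (rule sum.swap)
  also have "\<dots> = (\<Sum>q\<in>splits m.
      (\<Sum>a\<in>?D. mv_coeff f a * E a (fst q)) * (\<Sum>b\<in>?D. mv_coeff g b * E b (snd q)))"
    by (simp only: sum_product sum.cartesian_product case_prod_unfold)
  also have "\<dots> = (\<Sum>q\<in>splits m. mv_coeff (mv_subst s f) (fst q) * mv_coeff (mv_subst s g) (snd q))"
  proof (rule sum.cong [OF refl])
    fix q assume "q \<in> splits m"
    then have "preds (fst q) \<subseteq> ?D" "preds (snd q) \<subseteq> ?D"
      by (auto simp: splits_def intro!: preds_mono)
    then show "(\<Sum>a\<in>?D. mv_coeff f a * E a (fst q)) * (\<Sum>b\<in>?D. mv_coeff g b * E b (snd q)) =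
        mv_coeff (mv_subst s f) (fst q) * mv_coeff (mv_subst s g) (snd q)"
      by (simp add: mv_coeff_subst [OF finite_preds] E_def)
  qed
  also have "\<dots> = mv_coeff (mv_subst s f * mv_subst s g) m"
    by (simp add: mv_coeff_mult case_prod_unfold)
  finally show "mv_coeff (mv_subst s (f * g)) m = mv_coeff (mv_subst s f * mv_subst s g) m" .
qed

lemma subst_part_prod: "mv_subst s (part_prod g l) = part_prod (\<lambda>k. mv_subst s (g k)) l"
  by (induction l) (simp_all add: subst_1 subst_mult)

lemma vanishes_below_subst:
  assumes "vanishes_below n f"
  shows "vanishes_below n (mv_subst s f)"
  unfolding vanishes_below_def
proof (intro allI impI)
  fix m :: "nat multiset" assume "size m < n"
  then show "mv_coeff (mv_subst s f) m = 0"
    using assms by (auto simp: mv_coeff_subst_preds in_preds_iff vanishes_below_def intro!: sum.neutral)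
qed

text \<open>Substitution never lowers the degree, so degree \<open>n\<close> of the image sees only
  degrees up to \<open>n\<close> of \<open>f\<close>, and of these only \<open>n\<close> is
  left.\<close>

lemma hom_comp_subst_lead:
  assumes "vanishes_below n f"
  shows "hom_comp n (mv_subst s f) = hom_comp n (mv_subst s (hom_comp n f))"
proof (rule mvps_eqI)
  fix m
  have "mv_coeff (mv_subst s f) m = mv_coeff (mv_subst s (hom_comp n f)) m" if "size m = n"
    by (rule mv_coeff_subst_cong) (use assms that in \<open>auto simp: in_preds_iff vanishes_below_def\<close>)
  then show "mv_coeff (hom_comp n (mv_subst s f)) m = mv_coeff (hom_comp n (mv_subst s (hom_comp n f))) m"
    by simp
qed

text \<open>The image is the sum over j of \<open>g oo h j\<close> in the variable
  \<open>r j\<close>, without constant terms. Several j contribute to the same variable when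
  \<open>r\<close> identifies them.\<close>

lemma mv_coeff_subst_fps_psum:
  "mv_coeff (mv_subst s (fps_psum g)) m =
    (\<Sum>j\<in>r -` set_mset m. if set_mset m = {r j} then fps_nth (g oo h j) (size m) else 0)"
proof -
  let ?J = "r -` set_mset m"
  let ?P = "{m' \<in> preds m. card (set_mset m') = 1}"
  have "mv_coeff (mv_subst s (fps_psum g)) m =
      (\<Sum>m'\<in>?P. mv_coeff (fps_psum g) m' * mv_coeff (\<Prod>i\<in>#m'. s i) m)"
    unfolding mv_coeff_subst_preds by (rule sum.mono_neutral_right) (auto simp: mv_coeff_fps_psum)
  also have "\<dots> = (\<Sum>p\<in>?J \<times> {1..size m}. fps_nth g (snd p) * mv_coeff (s (fst p) ^ snd p) m)"
  \<comment> \<open>The contributing monomials are the pure powers of x_j with positive exponent k,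
    indexed by the pair (j, k).\<close>
  proof (rule sum.reindex_bij_witness [where
        j = "\<lambda>m'. (the_elem (set_mset m'), size m')" and i = "\<lambda>p. replicate_mset (snd p) (fst p)"])
    fix m' assume "m' \<in> ?P"
    then have pred: "m' \<in> preds m" and "card (set_mset m') = 1" by auto
    then obtain j where j: "set_mset m' = {j}" by (auto simp: card_1_singleton_iff)
    then have "set_mset m' \<subseteq> {j}" by simp
    then obtain n where n: "m' = replicate_mset n j" by (rule set_mset_subset_singletonE)
    have "n > 0" using j n by (cases n) auto
    show "replicate_mset (snd (the_elem (set_mset m'), size m'))
        (fst (the_elem (set_mset m'), size m')) = m'"
      using \<open>n > 0\<close> by (simp add: n)
    show "(the_elem (set_mset m'), size m') \<in> ?J \<times> {1..size m}"
      using \<open>n > 0\<close> pred by (simp add: n in_preds_iff)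
    show "fps_nth g (snd (the_elem (set_mset m'), size m')) *
        mv_coeff (s (fst (the_elem (set_mset m'), size m')) ^ snd (the_elem (set_mset m'), size m')) m =
       mv_coeff (fps_psum g) m' * mv_coeff (\<Prod>i\<in>#m'. s i) m"
      using \<open>n > 0\<close> by (simp add: n mv_coeff_fps_psum)
  qed (auto simp: in_preds_iff)
  also have "\<dots> = (\<Sum>j\<in>?J. \<Sum>k=1..size m. fps_nth g k * mv_coeff (s j ^ k) m)"
    by (subst sum.cartesian_product) (simp add: case_prod_unfold)
  also have "\<dots> = (\<Sum>j\<in>?J. if set_mset m = {r j} then fps_nth (g oo h j) (size m) else 0)"
  proof (rule sum.cong [OF refl])
    fix j assume "j \<in> ?J"
    then have j: "r j \<in> set_mset m" by simp
    show "(\<Sum>k=1..size m. fps_nth g k * mv_coeff (s j ^ k) m) =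
        (if set_mset m = {r j} then fps_nth (g oo h j) (size m) else 0)"
    proof (cases "set_mset m = {r j}")
      case True
      then have "m \<noteq> {#}" by auto
      have "(\<Sum>k=1..size m. fps_nth g k * mv_coeff (s j ^ k) m) =
          (\<Sum>k=1..size m. fps_nth g k * fps_nth (h j ^ k) (size m))"
        using True by (simp add: s_def mv_of_fps_power [symmetric] mv_coeff_mv_of_fps)
      \<comment> \<open>The added term k = 0 vanishes, since the series 1 has no coefficient in
        positive degree.\<close>
      also have "\<dots> = (\<Sum>k=0..size m. fps_nth g k * fps_nth (h j ^ k) (size m))"
        using \<open>m \<noteq> {#}\<close> by (intro sum.mono_neutral_left) (auto simp: not_less_eq_eq)
      finally show ?thesis using True by (simp add: fps_compose_nth)
    next
      case False
      then have "\<not> set_mset m \<subseteq> {r j}" using j by auto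
      then show ?thesis
        using False by (simp add: s_def mv_of_fps_power [symmetric] mv_coeff_mv_of_fps)
    qed
  qed
  finally show ?thesis .
qed

end

lemma card_eq_1_of_mem: "i \<in> A \<Longrightarrow> card A = 1 \<longleftrightarrow> A = {i}"
  by (auto simp: card_1_singleton_iff)

lemma subst_fps_psum_same:
  assumes "fps_nth (h :: 'a::field fps) 0 = 0"
  shows "mv_subst (\<lambda>i. mv_of_fps i h) (fps_psum g) = fps_psum (g oo h)"
proof -
  interpret variable_subst "\<lambda>i. i" "\<lambda>_. h"
    by unfold_locales (use assms in auto)
  have s: "(\<lambda>i. mv_of_fps i h) = s" by (simp add: s_def fun_eq_iff)
  show ?thesis unfolding s
  proof (rule mvps_eqI)
    fix m
    have "mv_coeff (mv_subst s (fps_psum g)) m =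
        (\<Sum>j\<in>set_mset m. if set_mset m = {j} then fps_nth (g oo h) (size m) else 0)"
      by (simp add: mv_coeff_subst_fps_psum)
    also have "\<dots> = mv_coeff (fps_psum (g oo h)) m"
    proof (cases "card (set_mset m) = 1")
      case True
      then obtain j where "set_mset m = {j}" by (auto simp: card_1_singleton_iff)
      then show ?thesis by (simp add: mv_coeff_fps_psum)
    next
      case False
      then show ?thesis
        by (auto simp: mv_coeff_fps_psum card_eq_1_of_mem intro!: sum.neutral)
    qed
    finally show "mv_coeff (mv_subst s (fps_psum g)) m = mv_coeff (fps_psum (g oo h)) m" .
  qed
qed


section \<open>The cancellation property\<close>

lemma fbar_nth_1 [simp]: "fps_nth fbar (Suc 0) = -1"
  using arg_cong [OF fbar_mult, of "\<lambda>f. fps_nth f 1"] by (simp add: fps_mult_nth_1)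

lemma fhalf_nth_1 [simp]: "fps_nth fhalf (Suc 0) = 1"
  using arg_cong [OF fhalf_mult, of "\<lambda>f. fps_nth f 1"] by (simp add: fps_mult_nth_1)

lemma one_plus_const_mult_X_neq_0: "1 + fps_const c * fps_X \<noteq> (0 :: rat_beta fps)"
proof
  assume "1 + fps_const c * fps_X = 0"
  then have "fps_nth (1 + fps_const c * fps_X) 0 = fps_nth 0 0" by (rule arg_cong)
  then show False by simp
qed

text \<open>The bar is an involution: both sides give \<open>- fbar\<close> when multiplied by the
  nonzero series 1 + \<beta> \<open>fbar\<close>.\<close>

lemma fbar_compose_fbar: "fbar oo fbar = fps_X"
proof -
  let ?c = "fps_const beta"
  have "(fbar oo fbar) * (1 + ?c * fbar) = - fbar"
    using arg_cong [OF fbar_mult, of "\<lambda>f. f oo fbar"]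
    by (simp add: fps_compose_mult_distrib fps_compose_add_distrib fps_compose_uminus)
  moreover have "fps_X * (1 + ?c * fbar) = - fbar"
  proof -
    have "fps_X * (1 + ?c * fbar) * (1 + ?c * fps_X) =
        fps_X * (1 + ?c * fps_X + ?c * (fbar * (1 + ?c * fps_X)))"
      by (simp only: algebra_simps mult_1_left mult_1_right)
    also have "\<dots> = fps_X"
      by (simp add: fbar_mult)
    also have "\<dots> = (- fbar) * (1 + ?c * fps_X)"
      unfolding mult_minus_left fbar_mult by simp
    finally show ?thesis
      by (simp only: mult_right_cancel [OF one_plus_const_mult_X_neq_0])
  qed
  moreover have "1 + ?c * fbar \<noteq> 0"
  proof
    assume "1 + ?c * fbar = 0"
    then have "fps_nth (1 + ?c * fbar) 0 = fps_nth 0 0" by (rule arg_cong)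
    then show False by simp
  qed
  ultimately show ?thesis by (metis mult_right_cancel)
qed

text \<open>In the coordinate \<open>fhalf\<close> the bar becomes a change of sign, which is why
  odd powers of \<open>fhalf\<close> have the cancellation property.\<close>

lemma fhalf_compose_fbar: "fhalf oo fbar = - fhalf"
proof -
  let ?c = "fps_const beta" and ?h = "fps_const (beta / 2)"
  have c: "?c = ?h + ?h" by simp
  have comp: "(fhalf oo fbar) * (1 + ?h * fbar) = fbar"
    using arg_cong [OF fhalf_mult, of "\<lambda>f. f oo fbar"]
    by (simp add: fps_compose_mult_distrib fps_compose_add_distrib)
  \<comment> \<open>The identity behind the proof: (1 + (\<beta>/2) bar u)(1 + \<beta> u) = 1 +
    (\<beta>/2) u.\<close>
  have "(1 + ?h * fbar) * (1 + ?c * fps_X) = 1 + ?c * fps_X + ?h * (fbar * (1 + ?c * fps_X))"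
    by (simp only: algebra_simps mult_1_left mult_1_right)
  also have "\<dots> = 1 + ?h * fps_X"
  proof -
    have "1 + (h + h) * x + h * (- x) = 1 + h * x" for h x :: "rat_beta fps"
      by (simp add: algebra_simps)
    then have "1 + ?c * fps_X + ?h * (- fps_X) = 1 + ?h * fps_X" by (simp only: c)
    then show ?thesis by (simp only: fbar_mult)
  qed
  finally have "(fhalf oo fbar) * (1 + ?h * fps_X) =
      (fhalf oo fbar) * (1 + ?h * fbar) * (1 + ?c * fps_X)"
    by (simp only: mult.assoc)
  also have "\<dots> = (- fhalf) * (1 + ?h * fps_X)"
    unfolding comp fbar_mult mult_minus_left fhalf_mult ..
  finally show ?thesis
    by (simp only: mult_right_cancel [OF one_plus_const_mult_X_neq_0])
qed

section \<open>The substitution (t, bar t, x_3, ...)\<close>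

definition KQ_var :: "nat \<Rightarrow> nat" where
  "KQ_var i = (if i = 1 then 0 else i)"

definition KQ_fps :: "nat \<Rightarrow> rat_beta fps" where
  "KQ_fps i = (if i = 1 then fbar else fps_X)"

text \<open>Variable 0 stands for t. Both x_0 and x_1 are sent to it, so variable 1 occurs in no
  image.\<close>

interpretation KQ: variable_subst KQ_var KQ_fps
proof
  show "finite {i. KQ_var i = j}" for j
    by (rule finite_subset [of _ "{1, j}"]) (auto simp: KQ_var_def split: if_splits)
qed (simp add: KQ_fps_def)

lemma KQ_cancellation_iff:
  "KQ_cancellation f \<longleftrightarrow> (\<forall>m. 0 \<in># m \<longrightarrow> mv_coeff (mv_subst KQ.s f) m = 0)"
proof -
  have "KQ.s = (\<lambda>i. if i = 1 then mv_of_fps 0 fbar else mv_var i)"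
    by (auto simp: KQ.s_def KQ_var_def KQ_fps_def mv_var_conv_mv_of_fps fun_eq_iff)
  then show ?thesis by (simp add: KQ_cancellation_def)
qed

lemma KQ_cancellation_1: "KQ_cancellation 1"
  by (auto simp: KQ_cancellation_iff KQ.subst_1 mv_coeff_1)

lemma KQ_cancellation_0: "KQ_cancellation 0"
  by (simp add: KQ_cancellation_iff KQ.subst_0)

lemma KQ_cancellation_add: "KQ_cancellation f \<Longrightarrow> KQ_cancellation g \<Longrightarrow> KQ_cancellation (f + g)"
  by (simp add: KQ_cancellation_iff KQ.subst_add)

lemma KQ_cancellation_const_mult: "KQ_cancellation f \<Longrightarrow> KQ_cancellation (mv_const c * f)"
  by (simp add: KQ_cancellation_iff KQ.subst_const_mult mv_coeff_const_mult)

lemma KQ_cancellation_mult: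
  assumes "KQ_cancellation f" "KQ_cancellation g"
  shows "KQ_cancellation (f * g)"
  unfolding KQ_cancellation_iff KQ.subst_mult
proof (intro allI impI, rule ccontr)
  fix m :: "nat multiset" assume "0 \<in># m" "mv_coeff (mv_subst KQ.s f * mv_subst KQ.s g) m \<noteq> 0"
  then show False
    using assms unfolding KQ_cancellation_iff by (elim mv_coeff_mult_nzE) auto
qed

text \<open>Variable 0 collects g(t) from x_0 and g(bar t) from x_1; all variables of index at least
  2 stay in place.\<close>

lemma KQ_subst_fps_psum:
  "mv_coeff (mv_subst KQ.s (fps_psum g)) m =
    (if set_mset m = {0} then fps_nth g (size m) + fps_nth (g oo fbar) (size m)
     else if card (set_mset m) = 1 \<and> 1 \<notin># m then fps_nth g (size m) else 0)"
proof -
  let ?t = "\<lambda>j. if set_mset m = {KQ_var j} then fps_nth (g oo KQ_fps j) (size m) else 0"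
  have eq: "mv_coeff (mv_subst KQ.s (fps_psum g)) m = (\<Sum>j\<in>KQ_var -` set_mset m. ?t j)"
    by (rule KQ.mv_coeff_subst_fps_psum)
  consider "set_mset m = {0}" | j where "set_mset m = {j}" "j \<noteq> 0" | "card (set_mset m) \<noteq> 1"
    by (auto simp: card_1_singleton_iff)
  then show ?thesis
  proof cases
    case 1
    have "KQ_var -` {0} = {0, 1}" by (auto simp: KQ_var_def split: if_splits)
    then show ?thesis unfolding eq 1 by (simp add: KQ_var_def KQ_fps_def)
  next
    case (2 j)
    have "KQ_var -` {j} = (if j = 1 then {} else {j})"
      using \<open>j \<noteq> 0\<close> by (auto simp: KQ_var_def split: if_splits)
    then show ?thesis unfolding eq 2 using \<open>j \<noteq> 0\<close> by (auto simp: KQ_var_def KQ_fps_def)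
  next
    case 3
    then have "set_mset m \<noteq> {i}" for i by auto
    then show ?thesis unfolding eq using 3 by simp
  qed
qed

text \<open>After the substitution t occurs only through g(t) + g(bar t), which is zero by
  antisymmetry.\<close>

lemma KQ_cancellation_fps_psum:
  assumes "g oo fbar = - g"
  shows "KQ_cancellation (fps_psum g)"
  unfolding KQ_cancellation_iff
proof (intro allI impI)
  fix m :: "nat multiset" assume "0 \<in># m"
  then have "card (set_mset m) = 1 \<Longrightarrow> set_mset m = {0}"
    using card_eq_1_of_mem [of 0 "set_mset m"] by simp
  then show "mv_coeff (mv_subst KQ.s (fps_psum g)) m = 0"
    unfolding KQ_subst_fps_psum assms by simp
qed


section \<open>Spans of products indexed by partitions\<close>

definition deg_part :: "nat multiset set \<Rightarrow> nat \<Rightarrow> nat multiset set" where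
  "deg_part I d = {l \<in> I. sum_mset l = d}"

lemma member_le_sum_mset: "k \<in># l \<Longrightarrow> k \<le> (sum_mset l :: nat)"
  by (auto dest: multi_member_split)

lemma size_le_sum_mset: "0 \<notin># l \<Longrightarrow> size l \<le> sum_mset l"
  by (induction l) auto

lemma finite_deg_part:
  assumes "I \<subseteq> partitions"
  shows "finite (deg_part I d)"
proof (rule finite_subset)
  show "deg_part I d \<subseteq> (\<Union>n\<le>d. multisets_of_size {..d} n)"
    using assms
    by (auto simp: deg_part_def partitions_def multisets_of_size_def
        intro: size_le_sum_mset member_le_sum_mset)
  show "finite (\<Union>n\<le>d. multisets_of_size {..d} n)" by auto
qed

abbreviation part_span :: "nat multiset set \<Rightarrow> (nat \<Rightarrow> 'a::field mvps) \<Rightarrow> nat \<Rightarrow> 'a mvps set" where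
  "part_span I g d \<equiv> mvs.span (part_prod g ` deg_part I d)"

lemma part_span_base: "l \<in> I \<Longrightarrow> sum_mset l = d \<Longrightarrow> part_prod g l \<in> part_span I g d"
  by (rule mvs.span_base) (simp add: deg_part_def)

text \<open>For an index set closed under union the spans form a graded algebra. This applies to all
  partitions and to the odd ones, but not to the strict ones.\<close>

lemma part_span_mult:
  assumes I: "\<And>l l'. l \<in> I \<Longrightarrow> l' \<in> I \<Longrightarrow> l + l' \<in> I"
    and "f \<in> part_span I g d" "f' \<in> part_span I g e"
  shows "f * f' \<in> part_span I g (d + e)"
proof -
  have *: "part_prod g l * f' \<in> part_span I g (d + e)" if "l \<in> deg_part I d" for l
    using assms(3)
  proof (induction rule: mvs.span_induct_alt)
    case (step c x y)
    then obtain l' where "l' \<in> deg_part I e" "x = part_prod g l'" by blast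
    with that have "part_prod g l * x \<in> part_span I g (d + e)"
      by (simp add: deg_part_def part_prod_union [symmetric] part_span_base [unfolded deg_part_def] I)
    moreover have "part_prod g l * (mv_const c * x + y) = mv_const c * (part_prod g l * x) + part_prod g l * y"
      by (simp add: algebra_simps)
    ultimately show ?case using step by (simp add: mvs.span_add mvs.span_scale)
  qed (simp add: mvs.span_zero)
  show ?thesis
    using assms(2)
  proof (induction rule: mvs.span_induct_alt)
    case (step c x y)
    then have "x * f' \<in> part_span I g (d + e)" using * by blast
    moreover have "(mv_const c * x + y) * f' = mv_const c * (x * f') + y * f'"
      by (simp add: algebra_simps)
    ultimately show ?case using step by (simp add: mvs.span_add mvs.span_scale)
  qed (simp add: mvs.span_zero)
qed

lemma part_span_1: "{#} \<in> I \<Longrightarrow> 1 \<in> part_span I g 0"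
  using part_span_base [of "{#}" I 0 g] by simp

text \<open>The coefficients are indexed by \<open>A\<close> and not by the image, so
  \<open>b\<close> may repeat values.\<close>

lemma span_imageE:
  assumes "f \<in> mvs.span (b ` A)" "finite A"
  obtains c where "f = (\<Sum>i\<in>A. mv_const (c i) * b i)"
proof -
  have "\<exists>c. f = (\<Sum>i\<in>A. mv_const (c i) * b i)"
    using assms(1)
  proof (induction rule: mvs.span_induct_alt)
    case base
    show ?case by (rule exI [of _ "\<lambda>_. 0"]) simp
  next
    case (step a x y)
    then obtain i c where i: "i \<in> A" "x = b i" and c: "y = (\<Sum>i\<in>A. mv_const (c i) * b i)" by blast
    have "(\<Sum>j\<in>A. mv_const ((if j = i then a else 0) + c j) * b j) =
        (\<Sum>j\<in>A. (if j = i then mv_const a * b i else 0) + mv_const (c j) * b j)"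
      by (rule sum.cong) (auto simp: mv_const_add algebra_simps)
    also have "\<dots> = mv_const a * x + y"
      using assms(2) i c by (simp add: sum.distrib)
    finally show ?case by metis
  qed
  then show ?thesis using that by blast
qed

lemma partitions_add: "l \<in> partitions \<Longrightarrow> l' \<in> partitions \<Longrightarrow> l + l' \<in> partitions"
  by (auto simp: partitions_def)

lemma odd_partitions_subset: "odd_partitions \<subseteq> partitions"
  by (auto simp: odd_partitions_def)

lemma strict_partitions_subset: "strict_partitions \<subseteq> partitions"
  by (auto simp: strict_partitions_def)

lemma odd_partitions_add: "l \<in> odd_partitions \<Longrightarrow> l' \<in> odd_partitions \<Longrightarrow> l + l' \<in> odd_partitions"
  by (auto simp: odd_partitions_def partitions_def)

lemma vanishes_below_psum: "vanishes_below k (psum k)"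
  by (cases "k = 0") (auto simp: psum_conv_fps_psum intro!: vanishes_below_fps_psum)

lemma hom_comp_psum: "hom_comp k (psum n) = (if k = n then psum n else 0)" if "n > 0"
  by (rule mvps_eqI) (use that in \<open>auto simp: psum_conv_fps_psum mv_coeff_fps_psum\<close>)

lemma hom_comp_part_prod_psum:
  assumes "l \<in> partitions"
  shows "hom_comp d (part_prod psum l) = (if d = sum_mset l then part_prod psum l else 0)"
  using assms
proof (induction l arbitrary: d)
  case empty
  show ?case by (simp add: hom_comp_1)
next
  case (add k l)
  then have k: "k > 0" and l: "l \<in> partitions" by (auto simp: partitions_def)
  have "hom_comp d (psum k * part_prod psum l) =
      (\<Sum>i\<le>d. if i = k then (if d - k = sum_mset l then psum k * part_prod psum l else 0) else 0)"
    unfolding hom_comp_mult by (rule sum.cong) (auto simp: hom_comp_psum [OF k] add.IH [OF l])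
  also have "\<dots> = (if d = k + sum_mset l then psum k * part_prod psum l else 0)"
    by (auto simp: sum.delta)
  finally show ?case by simp
qed

text \<open>
  The first condition is the description of \<^const>\<open>Lambda_hat\<close> by homogeneous components; in this
  form it is evidently stable under the ring operations.
\<close>

definition GG :: "rat_beta mvps set" where
  "GG = {f. (\<forall>d. hom_comp d f \<in> part_span partitions psum d) \<and> KQ_cancellation f}"

lemma GGamma_subset_GG: "GGamma \<subseteq> GG"
proof
  fix f assume "f \<in> GGamma"
  then obtain c where c: "is_inf_lincomb partitions (part_prod psum) c f" and "KQ_cancellation f"
    by (auto simp: GGamma_def Lambda_hat_def)
  have "hom_comp d f \<in> part_span partitions psum d" for d
  proof -
    have "hom_comp d (mv_const (c l) * part_prod psum l) \<in> part_span partitions psum d"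
      if "l \<in> partitions" for l
      using that
      by (auto simp: hom_comp_const_mult hom_comp_part_prod_psum mvs.span_zero
          intro!: mvs.span_scale part_span_base)
    then show ?thesis
      using c by (auto simp: is_inf_lincomb_def intro!: mvs.span_sum)
  qed
  with \<open>KQ_cancellation f\<close> show "f \<in> GG" by (simp add: GG_def)
qed

lemma GG_0: "0 \<in> GG"
  by (simp add: GG_def mvs.span_zero KQ_cancellation_0)

lemma GG_1: "1 \<in> GG"
  by (auto simp: GG_def hom_comp_1 mvs.span_zero KQ_cancellation_1 partitions_def intro!: part_span_1)

lemma GG_add: "f \<in> GG \<Longrightarrow> g \<in> GG \<Longrightarrow> f + g \<in> GG"
  by (simp add: GG_def hom_comp_add mvs.span_add KQ_cancellation_add)

lemma GG_const_mult: "f \<in> GG \<Longrightarrow> mv_const c * f \<in> GG"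
  by (simp add: GG_def hom_comp_const_mult mvs.span_scale KQ_cancellation_const_mult)

lemma GG_diff: "f \<in> GG \<Longrightarrow> g \<in> GG \<Longrightarrow> f - g \<in> GG"
  using GG_add [of f "mv_const (-1) * g"] GG_const_mult [of g "-1"] by (simp add: mv_const_uminus)

lemma GG_mult:
  assumes "f \<in> GG" "g \<in> GG"
  shows "f * g \<in> GG"
proof -
  have "hom_comp d (f * g) \<in> part_span partitions psum d" for d
    unfolding hom_comp_mult
  proof (rule mvs.span_sum)
    fix i assume "i \<in> {..d}"
    then show "hom_comp i f * hom_comp (d - i) g \<in> part_span partitions psum d"
      using part_span_mult [OF partitions_add, of "hom_comp i f" psum i "hom_comp (d - i) g" "d - i"] assms
      by (simp add: GG_def)
  qed
  then show ?thesis using assms by (simp add: GG_def KQ_cancellation_mult)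
qed

lemma GG_sum: "(\<And>i. i \<in> A \<Longrightarrow> F i \<in> GG) \<Longrightarrow> sum F A \<in> GG"
  by (induction A rule: infinite_finite_induct) (simp_all add: GG_0 GG_add)

lemma GG_part_prod: "(\<And>k. k \<in># l \<Longrightarrow> g k \<in> GG) \<Longrightarrow> part_prod g l \<in> GG"
  by (induction l) (simp_all add: GG_1 GG_mult)

text \<open>Antisymmetric series in one variable are the source of all members of \<open>GG\<close>
  constructed below.\<close>

lemma GG_fps_psum:
  assumes "g oo fbar = - g"
  shows "fps_psum g \<in> GG"
proof -
  have "hom_comp d (fps_psum g) \<in> part_span partitions psum d" for d
  proof (cases "d = 0")
    case False
    have "part_prod psum {#d#} \<in> part_span partitions psum d"
      by (rule part_span_base) (use False in \<open>auto simp: partitions_def\<close>)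
    then show ?thesis using False by (simp add: hom_comp_fps_psum mvs.span_scale)
  qed (simp add: hom_comp_0_fps_psum mvs.span_zero)
  then show ?thesis by (simp add: GG_def KQ_cancellation_fps_psum assms)
qed


section \<open>Products of power sums and the number of parts\<close>

text \<open>The partition formed by the exponents, that is, the index of the monomial symmetric
  function to which \<open>m\<close> belongs.\<close>

definition exponents :: "nat multiset \<Rightarrow> nat multiset" where
  "exponents m = image_mset (count m) (mset_set (set_mset m))"

lemma size_exponents: "size (exponents m) = card (set_mset m)"
  by (simp add: exponents_def)

lemma sum_mset_exponents: "sum_mset (exponents m) = size m"
  by (simp add: exponents_def size_multiset_overloaded_eq sum_unfold_sum_mset)

lemma exponents_empty [simp]: "exponents {#} = {#}"
  by (simp add: exponents_def)

lemma exponents_add: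
  assumes "j \<notin># b" "k > 0"
  shows "exponents (replicate_mset k j + b) = add_mset k (exponents b)"
proof -
  have "set_mset (replicate_mset k j + b) = insert j (set_mset b)"
    using assms by auto
  moreover have "image_mset (count (replicate_mset k j + b)) (mset_set (set_mset b)) =
      image_mset (count b) (mset_set (set_mset b))"
    by (rule image_mset_cong) (use assms in auto)
  moreover have "count b j = 0" using assms by (simp add: count_eq_zero_iff)
  ultimately show ?thesis
    using assms by (simp add: exponents_def)
qed

text \<open>Every part k contributes a k-th power of one variable. If there are as many variables as
  parts, no two parts share a variable and the exponents are exactly the parts.\<close>

lemma part_prod_pure_nz:
  assumes pure: "\<And>k a. k > 0 \<Longrightarrow> mv_coeff (g k) a \<noteq> 0 \<Longrightarrow> \<exists>j. a = replicate_mset k j"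
    and "0 \<notin># l" "mv_coeff (part_prod g l) m \<noteq> (0 :: 'a::comm_ring_1)"
  shows "card (set_mset m) \<le> size l \<and> (card (set_mset m) = size l \<longrightarrow> exponents m = l)"
  using assms(2,3)
proof (induction l arbitrary: m)
  case empty
  then show ?case by (auto simp: mv_coeff_1 split: if_splits)
next
  case (add k l)
  then have k: "k > 0" and l: "0 \<notin># l" by auto
  from add.prems obtain a b where m: "m = a + b" and a: "mv_coeff (g k) a \<noteq> 0"
    and b: "mv_coeff (part_prod g l) b \<noteq> 0"
    unfolding part_prod_add_mset by (elim mv_coeff_mult_nzE)
  from pure [OF k a] obtain j where j: "a = replicate_mset k j" by blast
  have IH: "card (set_mset b) \<le> size l" "card (set_mset b) = size l \<Longrightarrow> exponents b = l"
    using add.IH [OF l b] by auto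
  have set: "set_mset m = insert j (set_mset b)" using k by (simp add: m j)
  show ?case
  proof (cases "j \<in># b")
    case True
    then have "set_mset m = set_mset b" using set by auto
    then show ?thesis using IH by simp
  next
    case False
    then have "card (set_mset m) = Suc (card (set_mset b))" by (simp add: set)
    then show ?thesis using IH exponents_add [OF False k] by (auto simp: m j)
  qed
qed

lemma part_prod_nonneg:
  fixes g :: "nat \<Rightarrow> 'a::linordered_idom mvps"
  assumes "\<And>k a. k \<in># l \<Longrightarrow> mv_coeff (g k) a \<ge> 0"
  shows "mv_coeff (part_prod g l) m \<ge> 0"
  using assms by (induction l arbitrary: m) (simp_all add: mv_coeff_1 mv_coeff_mult_nonneg)

text \<open>The infinite set \<open>V\<close> supplies a fresh variable for each part, and
  nonnegativity excludes cancellation.\<close>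

lemma part_prod_pos:
  fixes g :: "nat \<Rightarrow> 'a::linordered_idom mvps"
  assumes nonneg: "\<And>k a. k \<in># l \<Longrightarrow> mv_coeff (g k) a \<ge> 0"
    and pos: "\<And>k j. k \<in># l \<Longrightarrow> j \<in> V \<Longrightarrow> mv_coeff (g k) (replicate_mset k j) > 0"
    and "infinite V" "0 \<notin># l"
  shows "\<exists>m. mv_coeff (part_prod g l) m > 0 \<and> exponents m = l \<and> set_mset m \<subseteq> V"
  using assms
proof (induction l)
  case empty
  show ?case by (rule exI [of _ "{#}"]) (simp add: mv_coeff_1)
next
  case (add k l)
  then obtain b where b: "mv_coeff (part_prod g l) b > 0" "exponents b = l" "set_mset b \<subseteq> V"
    by auto
  from add.prems obtain j where j: "j \<in> V" "j \<notin># b"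
    by (metis finite_set_mset rev_finite_subset subsetI)
  have k: "k > 0" using add.prems by auto
  have "mv_coeff (part_prod g (add_mset k l)) (replicate_mset k j + b) > 0"
    unfolding part_prod_add_mset
    by (rule mv_coeff_mult_pos) (use add.prems b j in \<open>auto intro: part_prod_nonneg\<close>)
  then show ?case
    using b j k by (intro exI [of _ "replicate_mset k j + b"]) (auto simp: exponents_add)
qed

text \<open>Triangularity by length: purity bounds the number of parts of a contributing partition
  from below by the number of variables, \<open>longest\<close> bounds it from above, and equality
  forces \<open>exponents m\<close>.\<close>

lemma mv_coeff_sum_part_prod_exponents:
  fixes g :: "nat \<Rightarrow> 'a::comm_ring_1 mvps"
  assumes pure: "\<And>k a. k > 0 \<Longrightarrow> mv_coeff (g k) a \<noteq> 0 \<Longrightarrow> \<exists>j. a = replicate_mset k j"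
    and A: "finite A" "A \<subseteq> partitions" "exponents m \<in> A"
    and longest: "\<And>l. l \<in> A \<Longrightarrow> c l \<noteq> 0 \<Longrightarrow> mv_coeff (part_prod g l) m \<noteq> 0 \<Longrightarrow> size l \<le> card (set_mset m)"
  shows "mv_coeff (\<Sum>l\<in>A. mv_const (c l) * part_prod g l) m =
    c (exponents m) * mv_coeff (part_prod g (exponents m)) m"
proof -
  have "mv_coeff (\<Sum>l\<in>A. mv_const (c l) * part_prod g l) m =
      (\<Sum>l\<in>A. c l * mv_coeff (part_prod g l) m)"
    by (simp add: mv_coeff_sum mv_coeff_const_mult)
  also have "\<dots> = (\<Sum>l\<in>{exponents m}. c l * mv_coeff (part_prod g l) m)"
  proof (rule sum.mono_neutral_right)
    show "\<forall>l\<in>A - {exponents m}. c l * mv_coeff (part_prod g l) m = 0"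
    proof (rule ballI, rule ccontr)
      fix l assume l: "l \<in> A - {exponents m}" and "c l * mv_coeff (part_prod g l) m \<noteq> 0"
      then have nz: "c l \<noteq> 0" "mv_coeff (part_prod g l) m \<noteq> 0" by auto
      have "0 \<notin># l" using l A by (auto simp: partitions_def)
      from part_prod_pure_nz [OF pure this nz(2)] longest [OF _ nz] l show False by auto
    qed
  qed (use A in auto)
  finally show ?thesis by simp
qed

lemma ex_maximal_size:
  assumes "finite N" "N \<noteq> {}"
  shows "\<exists>l\<in>N. \<forall>l'\<in>N. size l' \<le> size l"
proof -
  have "Max (size ` N) \<in> size ` N" using assms by simp
  then obtain l where "l \<in> N" "size l = Max (size ` N)" by auto
  then show ?thesis using assms by (intro bexI [of _ l]) simp_all
qed

lemma mv_coeff_psum: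
  "k > 0 \<Longrightarrow> mv_coeff (psum k) m = (if card (set_mset m) = 1 \<and> size m = k then 1 else 0)"
  by (simp add: psum_conv_fps_psum mv_coeff_fps_psum)

lemma ex_replicate_mset_of_card_1:
  assumes "card (set_mset m) = 1"
  shows "\<exists>j. m = replicate_mset (size m) j"
proof -
  from assms obtain j where "set_mset m = {j}" by (auto simp: card_1_singleton_iff)
  then have "set_mset m \<subseteq> {j}" by simp
  then obtain n where "m = replicate_mset n j" by (rule set_mset_subset_singletonE)
  then show ?thesis by auto
qed

text \<open>The relation is read off at a monomial whose exponents are the parts of a longest
  partition with nonzero coefficient, where no other partition contributes.\<close>

lemma part_prod_psum_independent:
  assumes A: "finite A" "A \<subseteq> partitions"
    and sum: "(\<Sum>l\<in>A. mv_const (c l) * part_prod psum l) = 0" and "l \<in> A"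
  shows "c l = 0"
proof (rule ccontr)
  assume "c l \<noteq> 0"
  with \<open>l \<in> A\<close> A have "\<exists>l\<in>{l \<in> A. c l \<noteq> 0}. \<forall>l'\<in>{l \<in> A. c l \<noteq> 0}. size l' \<le> size l"
    by (intro ex_maximal_size) auto
  then obtain l0 where l0: "l0 \<in> A" "c l0 \<noteq> 0"
    and max: "\<And>l'. l' \<in> A \<Longrightarrow> c l' \<noteq> 0 \<Longrightarrow> size l' \<le> size l0" by blast
  have parts: "k \<in># l0 \<Longrightarrow> k > 0" for k using l0 A by (auto simp: partitions_def intro: gr0I)
  have "\<exists>m. mv_coeff (part_prod psum l0) m > 0 \<and> exponents m = l0 \<and> set_mset m \<subseteq> UNIV"
    by (rule part_prod_pos) (use parts in \<open>auto simp: mv_coeff_psum\<close>)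
  then obtain m where m: "mv_coeff (part_prod psum l0) m > 0" "exponents m = l0" by blast
  have "mv_coeff (\<Sum>l\<in>A. mv_const (c l) * part_prod psum l) m = c l0 * mv_coeff (part_prod psum l0) m"
    unfolding m(2) [symmetric]
  proof (rule mv_coeff_sum_part_prod_exponents)
    show "\<exists>j. a = replicate_mset k j" if "k > 0" "mv_coeff (psum k) a \<noteq> 0" for k a
      using that ex_replicate_mset_of_card_1 [of a] by (auto simp: mv_coeff_psum split: if_splits)
    show "size l \<le> card (set_mset m)" if "l \<in> A" "c l \<noteq> 0" for l
      using max [OF that] m by (simp add: size_exponents [symmetric])
  qed (use A l0 m in auto)
  with sum l0 m show False by simp
qed

text \<open>In lowest degree bar t is -t, so t^k appears with coefficient 1 + (-1)^k: zero for odd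
  \<open>k\<close>, two for even \<open>k\<close>.\<close>

lemma KQ_subst_psum_lead:
  assumes "k > 0"
  shows "mv_coeff (hom_comp k (mv_subst KQ.s (psum k))) m =
    (if size m \<noteq> k then 0 else if set_mset m = {0} then 1 + (-1) ^ k
     else if card (set_mset m) = 1 \<and> 1 \<notin># m then 1 else 0)"
proof -
  have comp: "fps_X ^ k oo fbar = fbar ^ k" by (simp add: fps_compose_power [OF fbar_nth_0, symmetric])
  have "fps_nth (fbar ^ k) k = (-1) ^ k" by (simp add: startsby_zero_power_nth_same)
  then show ?thesis
    by (simp add: psum_conv_fps_psum [OF assms] KQ_subst_fps_psum comp)
qed

text \<open>
  In a linear combination of the products \<open>p\<^sub>\<lambda>(t, -t, x\<^sub>3, \<dots>)\<close>, take a longest \<open>\<lambda>\<close> having an even part \<open>2k\<close>: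
  the monomial in which \<open>t\<close> has exponent \<open>2k\<close> and the other parts are exponents of distinct variables
  arises from no other \<open>\<lambda>\<close>.
\<close>

lemma lowest_component_GG:
  assumes "f \<in> GG" "vanishes_below d f"
  shows "hom_comp d f \<in> part_span odd_partitions psum d"
proof -
  let ?A = "deg_part partitions d"
  \<comment> \<open>For positive k, \<open>e k\<close> is the power sum of (t, -t, x_3, ...). Its
    coefficients are nonnegative, so products of the \<open>e k\<close> show no
    cancellation.\<close>
  define e where "e = (\<lambda>k. hom_comp k (mv_subst KQ.s (psum k)))"
  have A: "finite ?A" "?A \<subseteq> partitions"
    by (simp_all add: finite_deg_part) (auto simp: deg_part_def)
  have "hom_comp d f \<in> part_span partitions psum d" using assms(1) by (simp add: GG_def)
  then obtain c where c: "hom_comp d f = (\<Sum>l\<in>?A. mv_const (c l) * part_prod psum l)"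
    using A by (elim span_imageE)
  have e: "mv_coeff (e k) m =
      (if size m \<noteq> k then 0 else if set_mset m = {0} then 1 + (-1) ^ k
       else if card (set_mset m) = 1 \<and> 1 \<notin># m then 1 else 0)" if "k > 0" for k m
    unfolding e_def using that by (rule KQ_subst_psum_lead)
  have minus_one: "0 \<le> 1 + (- 1 :: rat_beta) ^ k" for k by (cases "even k") auto
  have e_nonneg: "0 \<le> mv_coeff (e k) a" if "k > 0" for k a
    unfolding e [OF that] by (auto simp: minus_one)
  \<comment> \<open>Products over odd partitions are free of t, so odd partitions of any length are
    invisible at monomials involving t.\<close>
  have e_odd: "0 \<notin># m" if "mv_coeff (part_prod e l) m \<noteq> 0" "l \<in> odd_partitions" for l m
    using that
  proof (induction l arbitrary: m)
    case empty
    then show ?case by (auto simp: mv_coeff_1 split: if_splits)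
  next
    case (add k l)
    then have k: "odd k" "l \<in> odd_partitions" by (auto simp: odd_partitions_def partitions_def)
    then have "k > 0" by (auto intro: gr0I)
    from add.prems obtain a b where ab: "m = a + b" "mv_coeff (e k) a \<noteq> 0" "mv_coeff (part_prod e l) b \<noteq> 0"
      unfolding part_prod_add_mset by (elim mv_coeff_mult_nzE)
    have "card (set_mset a) = 1 \<and> set_mset a \<noteq> {0}"
      using ab(2) k(1) unfolding e [OF \<open>k > 0\<close>] by (auto split: if_splits)
    then have "0 \<notin># a" using card_eq_1_of_mem [of 0 "set_mset a"] by blast
    with add.IH [OF ab(3) k(2)] ab(1) show ?case by simp
  qed
  \<comment> \<open>The cancellation property in degree \<open>d\<close>, where the substituted
    series depends only on the lowest component of \<open>f\<close>.\<close>
  have comb0: "mv_coeff (\<Sum>l\<in>?A. mv_const (c l) * part_prod e l) m = 0" if "0 \<in># m" "size m = d" for m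
  proof -
    have "hom_comp d (part_prod (\<lambda>k. mv_subst KQ.s (psum k)) l) = part_prod e l" if "l \<in> ?A" for l
      using that hom_comp_part_prod [of l "\<lambda>k. mv_subst KQ.s (psum k)"]
      by (auto simp: deg_part_def e_def KQ.vanishes_below_subst vanishes_below_psum)
    then have "hom_comp d (mv_subst KQ.s (hom_comp d f)) = (\<Sum>l\<in>?A. mv_const (c l) * part_prod e l)"
      by (simp add: c KQ.subst_sum KQ.subst_const_mult KQ.subst_part_prod hom_comp_sum hom_comp_const_mult)
    moreover have "mv_coeff (hom_comp d (mv_subst KQ.s f)) m = 0"
      using assms(1) that by (simp add: GG_def KQ_cancellation_iff)
    ultimately show ?thesis
      using KQ.hom_comp_subst_lead [OF assms(2)] by simp
  qed
  have zero: "c l = 0" if "l \<in> ?A" "l \<notin> odd_partitions" for l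
  proof (rule ccontr)
    let ?N = "{l \<in> ?A. c l \<noteq> 0 \<and> l \<notin> odd_partitions}"
    assume "c l \<noteq> 0"
    with that A have "\<exists>l\<in>?N. \<forall>l'\<in>?N. size l' \<le> size l" by (intro ex_maximal_size) auto
    then obtain l0 where l0: "l0 \<in> ?A" "c l0 \<noteq> 0" "l0 \<notin> odd_partitions"
      and max: "\<And>l'. l' \<in> ?A \<Longrightarrow> c l' \<noteq> 0 \<Longrightarrow> l' \<notin> odd_partitions \<Longrightarrow> size l' \<le> size l0" by blast
    have l0': "0 \<notin># l0" "sum_mset l0 = d" using l0 by (auto simp: deg_part_def partitions_def)
    obtain k where "k \<in># l0" "even k" using l0 A by (auto simp: odd_partitions_def)
    then obtain l1 where l1: "l0 = add_mset k l1" by (auto dest: multi_member_split)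
    have k: "k > 0" and "0 \<notin># l1" using l0' by (auto simp: l1)
    then have pos: "k' \<in># l1 \<Longrightarrow> k' > 0" for k' by (auto intro: gr0I)
    \<comment> \<open>The remaining parts use variables from index 2 on: 0 is reserved for t and 1
      is absent after the substitution.\<close>
    have "\<exists>b. mv_coeff (part_prod e l1) b > 0 \<and> exponents b = l1 \<and> set_mset b \<subseteq> {2..}"
    proof (rule part_prod_pos)
      show "mv_coeff (e k') (replicate_mset k' j) > 0" if "k' \<in># l1" "j \<in> {2..}" for k' j
        using that pos [of k'] by (simp add: e)
    qed (use pos e_nonneg \<open>0 \<notin># l1\<close> in \<open>auto simp: infinite_Ici\<close>)
    then obtain b where b: "mv_coeff (part_prod e l1) b > 0" "exponents b = l1" "set_mset b \<subseteq> {2..}"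
      by blast
    define m where "m = replicate_mset k 0 + b"
    have "0 \<notin># b" using b(3) by auto
    then have m: "exponents m = l0" "0 \<in># m"
      using b(2) k by (simp_all add: m_def exponents_add l1)
    have "size m = d" using m l0' sum_mset_exponents [of m] by simp
    have "mv_coeff (part_prod e l0) m > 0"
      unfolding l1 part_prod_add_mset m_def
    proof (rule mv_coeff_mult_pos [OF _ _ _ b(1)])
      show "mv_coeff (e k) (replicate_mset k 0) > 0" using k \<open>even k\<close> by (simp add: e)
    qed (use k pos in \<open>auto intro: e_nonneg part_prod_nonneg\<close>)
    moreover have "mv_coeff (\<Sum>l\<in>?A. mv_const (c l) * part_prod e l) m = c l0 * mv_coeff (part_prod e l0) m"
      unfolding m(1) [symmetric]
    proof (rule mv_coeff_sum_part_prod_exponents)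
      show "\<exists>j. a = replicate_mset k j" if "k > 0" "mv_coeff (e k) a \<noteq> 0" for k a
      proof -
        have "card (set_mset a) = 1" "size a = k"
          using that by (auto simp: e split: if_splits)
        then show ?thesis using ex_replicate_mset_of_card_1 [of a] by auto
      qed
      \<comment> \<open>An odd \<open>l\<close> cannot contribute because t occurs in
        \<open>m\<close>; for any other \<open>l\<close> the choice of \<open>l0\<close> bounds the
        length.\<close>
      show "size l \<le> card (set_mset m)" if "l \<in> ?A" "c l \<noteq> 0" "mv_coeff (part_prod e l) m \<noteq> 0" for l
        using max [OF that(1,2)] e_odd [OF that(3)] m by (auto simp: size_exponents [symmetric])
    qed (use A l0 m in auto)
    ultimately show False
      using comb0 [OF m(2) \<open>size m = d\<close>] l0(2) by simp
  qed
  show ?thesis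
    unfolding c
  proof (rule mvs.span_sum)
    fix l assume l: "l \<in> ?A"
    show "mv_const (c l) * part_prod psum l \<in> part_span odd_partitions psum d"
    proof (cases "l \<in> odd_partitions")
      case True
      with l have "part_prod psum l \<in> part_span odd_partitions psum d"
        by (intro part_span_base) (simp_all add: deg_part_def)
      then show ?thesis by (rule mvs.span_scale)
    next
      case False
      with zero l show ?thesis by (simp add: mvs.span_zero)
    qed
  qed
qed


section \<open>Newton's identity for \<open>q\<close> and its conjugate\<close>

lemma fps_nth_X_deriv: "fps_nth (fps_X * fps_deriv f) n = of_nat n * fps_nth (f :: 'a::comm_ring_1 fps) n"
  by (cases n) simp_all

definition geom :: "'a::comm_ring_1 \<Rightarrow> 'a fps" where
  "geom x = Abs_fps (\<lambda>n. x ^ n)"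

lemma geom_mult: "(1 - fps_const x * fps_X) * geom x = 1"
proof -
  have "(1 - fps_const x * fps_X) * fps_right_inverse (1 - fps_const x * fps_X) 1 = 1"
    by (rule fps_right_inverse) simp
  then show ?thesis by (simp only: geom_def fps_right_inverse_geom)
qed

text \<open>For F = (1 - yz)/(1 - xz), z F'/F = xz/(1 - xz) - yz/(1 - yz) = 1/(1 - xz) - 1/(1 - yz),
  written without division.\<close>

lemma log_deriv_factor:
  fixes x y :: "'a::comm_ring_1"
  defines "F \<equiv> (1 - fps_const y * fps_X) * geom x"
  shows "fps_X * fps_deriv F = F * (geom x - geom y)"
proof -
  define G H :: "'a fps" where "G = geom x" and "H = geom y"
  define a b :: "'a fps" where "a = fps_const x * fps_X" and "b = fps_const y * fps_X"
  have G: "(1 - a) * G = 1" and H: "(1 - b) * H = 1"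
    unfolding a_def b_def G_def H_def by (rule geom_mult)+
  have "fps_deriv ((1 - a) * G) = 0" by (simp add: G)
  then have "(1 - a) * fps_deriv G = fps_const x * G"
    by (simp add: a_def algebra_simps)
  then have "G * ((1 - a) * fps_deriv G) = G * (fps_const x * G)" by simp
  then have "((1 - a) * G) * fps_deriv G = fps_const x * G * G"
    by (simp only: mult_ac)
  then have dG: "fps_deriv G = fps_const x * G * G" by (simp add: G)
  have F: "F = (1 - b) * G" by (simp add: F_def b_def G_def)
  have aG: "a * G = G - 1" using G by (simp add: algebra_simps)
  have "fps_X * fps_deriv F = fps_X * (fps_deriv (1 - b) * G + (1 - b) * fps_deriv G)"
    unfolding F fps_deriv_mult by (simp only: add.commute)
  also have "\<dots> = (1 - b) * (a * G) * G - b * G"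
  proof -
    have "t * (- c * g + (1 - c * t) * (d * g * g)) = (1 - c * t) * (d * t * g) * g - c * t * g"
      for t c d g :: "'a fps" by (simp add: algebra_simps)
    moreover have "fps_deriv (1 - b) = - fps_const y" by (simp add: b_def)
    ultimately show ?thesis unfolding dG by (simp only: a_def b_def)
  qed
  also have "\<dots> = ((1 - b) * G) * G - ((1 - b) * H) * G"
    unfolding aG H by (simp add: algebra_simps)
  also have "\<dots> = F * (G - H)"
    unfolding F by (simp add: algebra_simps)
  finally show ?thesis by (simp add: G_def H_def)
qed

text \<open>The z^k coefficient of z F'/F for one factor F of the product, as a series in its
  variable.\<close>

definition q_log :: "nat \<Rightarrow> rat_beta fps" where
  "q_log k = fps_X ^ k - fbar ^ k"

lemma q_log_nth_0 [simp]: "fps_nth (q_log k) 0 = 0"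
  by (cases k) (simp_all add: q_log_def)

lemma q_log_0 [simp]: "q_log 0 = 0"
  by (simp add: q_log_def)

text \<open>The involution exchanges the two terms. This antisymmetry gives \<open>q\<close> its
  cancellation property.\<close>

lemma q_log_compose_fbar: "q_log k oo fbar = - q_log k"
  by (simp add: q_log_def fps_compose_sub_distrib fps_compose_power [OF fbar_nth_0, symmetric]
      fbar_compose_fbar)

lemma q_log_nth_less: "n < k \<Longrightarrow> fps_nth (q_log k) n = 0"
  using startsby_zero_power_prefix [of fbar k] by (simp add: q_log_def fps_X_power_nth)

lemma q_log_nth_same: "fps_nth (q_log k) k = 1 - (-1) ^ k"
  by (simp add: q_log_def fps_X_power_nth startsby_zero_power_nth_same)

lemma fps_psum_0 [simp]: "fps_psum 0 = 0"
  by (rule mvps_eqI) (simp add: mv_coeff_fps_psum)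

lemma fps_psum_uminus: "fps_psum (- g) = - fps_psum (g :: 'a::comm_ring_1 fps)"
  by (rule mvps_eqI) (simp add: mv_coeff_fps_psum)

lemma qfactor_log_deriv:
  "fps_X * fps_deriv (qfactor i) = qfactor i * Abs_fps (\<lambda>k. mv_of_fps i (q_log k))"
proof -
  have "geom (mv_var i) - geom (mv_of_fps i fbar) = Abs_fps (\<lambda>k. mv_of_fps i (q_log k))"
    by (rule fps_ext)
      (simp add: geom_def q_log_def mv_of_fps_diff mv_of_fps_power mv_var_conv_mv_of_fps)
  then show ?thesis
    using log_deriv_factor [of "mv_of_fps i fbar" "mv_var i"]
    by (simp add: qfactor_def fps_right_inverse_geom geom_def)
qed

lemma prod_qfactor_log_deriv:
  "fps_X * fps_deriv (\<Prod>i<N. qfactor i) =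
    (\<Prod>i<N. qfactor i) * (\<Sum>i<N. Abs_fps (\<lambda>k. mv_of_fps i (q_log k)))"
proof (induction N)
  case (Suc N)
  let ?P = "\<Prod>i<N. qfactor i"
  have "fps_X * fps_deriv (?P * qfactor N) =
      (fps_X * fps_deriv ?P) * qfactor N + ?P * (fps_X * fps_deriv (qfactor N))"
    by (simp add: algebra_simps)
  then show ?case unfolding Suc qfactor_log_deriv
    by (simp add: algebra_simps)
qed simp

text \<open>Monomials in the first \<open>N\<close> variables do not see the rest of the infinite
  sum. The zero constant term keeps \<open>N\<close> constants from accumulating.\<close>

lemma sum_mv_of_fps_conv_fps_psum:
  assumes "fps_nth g 0 = 0" "set_mset m \<subseteq> {..<N}"
  shows "(\<Sum>i<N. mv_coeff (mv_of_fps i g) m) = mv_coeff (fps_psum g) (m :: nat multiset)"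
proof -
  consider "m = {#}" | j where "set_mset m = {j}" | "m \<noteq> {#}" "card (set_mset m) \<noteq> 1"
    by (auto simp: card_1_singleton_iff)
  then show ?thesis
  proof cases
    case 1
    then show ?thesis by (simp add: mv_coeff_mv_of_fps mv_coeff_fps_psum assms)
  next
    case (2 j)
    have "(\<Sum>i<N. mv_coeff (mv_of_fps i g) m) = (\<Sum>i<N. if i = j then fps_nth g (size m) else 0)"
      by (rule sum.cong) (auto simp: mv_coeff_mv_of_fps 2)
    then show ?thesis using assms(2) by (simp add: mv_coeff_fps_psum 2)
  next
    case 3
    then have "\<not> set_mset m \<subseteq> {i}" for i by (auto simp: subset_singleton_iff)
    then show ?thesis using 3 by (simp add: mv_coeff_mv_of_fps mv_coeff_fps_psum)
  qed
qed

text \<open>The coefficients of z q'(z) = \<epsilon> q(z) S(z), where S collects the power sums of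
  x_j^k - bar x_j^k. The sign \<epsilon> treats \<open>qbeta\<close> and \<open>qbeta_bar\<close>
  together.\<close>

definition newton_recursion :: "rat_beta \<Rightarrow> (nat \<Rightarrow> rat_beta mvps) \<Rightarrow> bool" where
  "newton_recursion \<epsilon> q \<longleftrightarrow> q 0 = 1 \<and>
    (\<forall>n. of_nat n * q n = (\<Sum>i=0..n. q i * (mv_const \<epsilon> * fps_psum (q_log (n - i)))))"

text \<open>Finite products satisfy the identity by logarithmic differentiation. With
  \<open>N\<close> beyond all variables of \<open>m\<close>, the finite product already agrees with
  the limit at \<open>m\<close> and at its divisors.\<close>

lemma newton_recursion_qbeta: "newton_recursion 1 qbeta"
  unfolding newton_recursion_def
proof (intro conjI allI)
  have stable: "mv_coeff (qbeta n) a = mv_coeff (fps_nth (\<Prod>i<N. qfactor i) n) a"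
    if "set_mset a \<subseteq> {..<N}" for n a N
  proof -
    obtain M where M: "\<And>K. K \<ge> M \<Longrightarrow> mv_coeff (fps_nth (\<Prod>i<K. qfactor i) n) a = mv_coeff (qbeta n) a"
      using qbeta_convergent [of n a] unfolding eventually_sequentially by blast
    show ?thesis
      using M [of "max M N"] qbeta_stable [of a N "max M N" n] that by auto
  qed
  show "qbeta 0 = 1"
  proof (rule mvps_eqI)
    fix m :: "nat multiset"
    obtain N where N: "set_mset m \<subseteq> {..<N}" using finite_nat_iff_bounded [of "set_mset m"] by auto
    have "fps_nth (\<Prod>i<N. qfactor i) 0 = 1"
      by (induction N) (simp_all add: qfactor_def)
    then show "mv_coeff (qbeta 0) m = mv_coeff 1 m" by (simp add: stable [OF N])
  qed
  show "of_nat n * qbeta n = (\<Sum>i=0..n. qbeta i * (mv_const 1 * fps_psum (q_log (n - i))))" for n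
  proof (rule mvps_eqI)
    fix m :: "nat multiset"
    obtain N where N: "set_mset m \<subseteq> {..<N}" using finite_nat_iff_bounded [of "set_mset m"] by auto
    let ?P = "\<Prod>i<N. qfactor i"
    let ?L = "\<Sum>i<N. Abs_fps (\<lambda>k. mv_of_fps i (q_log k))"
    have L: "fps_nth ?L k = (\<Sum>i<N. mv_of_fps i (q_log k))" for k
      by (simp add: fps_sum_nth)
    have "mv_coeff (of_nat n * qbeta n) m = mv_coeff (fps_nth (fps_X * fps_deriv ?P) n) m"
      unfolding fps_nth_X_deriv mv_coeff_of_nat_mult stable [OF N] ..
    also have "\<dots> = (\<Sum>i=0..n. mv_coeff (fps_nth ?P i * fps_nth ?L (n - i)) m)"
      unfolding prod_qfactor_log_deriv fps_mult_nth mv_coeff_sum ..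
    also have "\<dots> = (\<Sum>i=0..n. mv_coeff (qbeta i * fps_psum (q_log (n - i))) m)"
    proof (intro sum.cong refl mv_coeff_mult_cong)
      fix i a assume "a \<subseteq># m"
      then have a: "set_mset a \<subseteq> {..<N}" using N set_mset_mono by blast
      show "mv_coeff (fps_nth ?P i) a = mv_coeff (qbeta i) a" by (simp add: stable [OF a])
      show "mv_coeff (fps_nth ?L (n - i)) a = mv_coeff (fps_psum (q_log (n - i))) a"
        unfolding L mv_coeff_sum by (rule sum_mv_of_fps_conv_fps_psum) (simp_all add: a)
    qed
    finally show "mv_coeff (of_nat n * qbeta n) m =
        mv_coeff (\<Sum>i=0..n. qbeta i * (mv_const 1 * fps_psum (q_log (n - i)))) m"
      by (simp add: mv_coeff_sum)
  qed
qed

text \<open>Barring all variables in the identity for \<open>qbeta\<close> negates every power sum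
  of \<open>q_log\<close>.\<close>

lemma newton_recursion_qbeta_bar: "newton_recursion (-1) qbeta_bar"
proof -
  interpret variable_subst "\<lambda>i. i" "\<lambda>_. fbar"
    by unfold_locales auto
  have s: "s = (\<lambda>i. mv_of_fps i fbar)" by (simp add: s_def fun_eq_iff)
  have q: "qbeta_bar n = mv_subst s (qbeta n)" for n by (simp add: qbeta_bar_def s)
  have S: "mv_subst s (fps_psum (q_log k)) = - fps_psum (q_log k)" for k
    by (simp add: s subst_fps_psum_same q_log_compose_fbar fps_psum_uminus)
  show ?thesis
    unfolding newton_recursion_def
  proof (intro conjI allI)
    show "qbeta_bar 0 = 1"
      using newton_recursion_qbeta by (simp add: newton_recursion_def q subst_1)
    show "of_nat n * qbeta_bar n =
        (\<Sum>i=0..n. qbeta_bar i * (mv_const (-1) * fps_psum (q_log (n - i))))" for n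
    proof -
      have "of_nat n * qbeta_bar n = mv_subst s (mv_const (of_nat n) * qbeta n)"
        by (simp only: subst_const_mult q mv_const_of_nat [symmetric])
      also have "mv_const (of_nat n) * qbeta n = (\<Sum>i=0..n. qbeta i * fps_psum (q_log (n - i)))"
        using newton_recursion_qbeta by (simp add: newton_recursion_def mv_const_of_nat)
      finally show ?thesis
        by (simp add: subst_sum subst_mult S q [symmetric] mv_const_uminus)
    qed
  qed
qed

text \<open>The term i = n drops out because \<open>q_log 0\<close> is zero, so \<open>q n\<close>
  is determined by its predecessors.\<close>

lemma newton_recursion_eq:
  assumes "newton_recursion \<epsilon> q" "n > 0"
  shows "q n = mv_const (1 / of_nat n) * (\<Sum>i<n. q i * (mv_const \<epsilon> * fps_psum (q_log (n - i))))"
proof -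
  have "mv_const (of_nat n) * q n = (\<Sum>i=0..n. q i * (mv_const \<epsilon> * fps_psum (q_log (n - i))))"
    using assms(1) by (simp add: newton_recursion_def mv_const_of_nat)
  also have "\<dots> = (\<Sum>i<n. q i * (mv_const \<epsilon> * fps_psum (q_log (n - i))))"
    by (rule sum.mono_neutral_right) (auto simp: not_less)
  finally have "mv_const (1 / of_nat n) * (mv_const (of_nat n) * q n) =
      mv_const (1 / of_nat n) * (\<Sum>i<n. q i * (mv_const \<epsilon> * fps_psum (q_log (n - i))))"
    by simp
  then show ?thesis using assms(2) by simp
qed

lemma vanishes_below_q_log: "vanishes_below k (fps_psum (q_log k))"
  by (rule vanishes_below_fps_psum) (rule q_log_nth_less)

lemma newton_recursion_vanishes_below:
  assumes "newton_recursion \<epsilon> q"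
  shows "vanishes_below n (q n)"
proof (induction n rule: less_induct)
  case (less n)
  show ?case
  proof (cases "n = 0")
    case False
    have "vanishes_below (i + (n - i)) (q i * (mv_const \<epsilon> * fps_psum (q_log (n - i))))" if "i < n" for i
      by (intro vanishes_below_mult vanishes_below_const_mult vanishes_below_q_log less that)
    then show ?thesis
      unfolding newton_recursion_eq [OF assms False [unfolded neq0_conv]]
      by (intro vanishes_below_const_mult vanishes_below_sum) simp
  qed simp
qed

lemma newton_recursion_GG:
  assumes "newton_recursion \<epsilon> q"
  shows "q n \<in> GG"
proof (induction n rule: less_induct)
  case (less n)
  show ?case
  proof (cases "n = 0")
    case True
    then show ?thesis using assms by (simp add: newton_recursion_def GG_1)
  next
    case False
    show ?thesis
      unfolding newton_recursion_eq [OF assms False [unfolded neq0_conv]]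
      by (intro GG_const_mult GG_sum GG_mult GG_fps_psum q_log_compose_fbar less) simp
  qed
qed

lemma hom_comp_q_log: "hom_comp k (fps_psum (q_log k)) = mv_const (1 - (-1) ^ k) * psum k"
  by (cases "k = 0") (simp_all add: hom_comp_fps_psum q_log_nth_same)

text \<open>The lowest component of the power sum of \<open>q_log k\<close> is 2 p_k for odd k and 0
  for even k, so \<beta> disappears.\<close>

lemma newton_recursion_lead:
  assumes "newton_recursion \<epsilon> q"
  shows "of_nat n * hom_comp n (q n) =
    (\<Sum>i=0..n. hom_comp i (q i) * (mv_const (\<epsilon> * (1 - (-1) ^ (n - i))) * psum (n - i)))"
proof -
  have "of_nat n * hom_comp n (q n) =
      (\<Sum>i=0..n. hom_comp n (q i * (mv_const \<epsilon> * fps_psum (q_log (n - i)))))"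
    using assms by (simp add: newton_recursion_def hom_comp_of_nat_mult [symmetric] hom_comp_sum)
  also have "\<dots> = (\<Sum>i=0..n. hom_comp i (q i) * hom_comp (n - i) (mv_const \<epsilon> * fps_psum (q_log (n - i))))"
  proof (rule sum.cong [OF refl])
    fix i assume i: "i \<in> {0..n}"
    have "vanishes_below (n - i) (mv_const \<epsilon> * fps_psum (q_log (n - i)))"
      by (intro vanishes_below_const_mult vanishes_below_q_log)
    from hom_comp_mult_lead [OF newton_recursion_vanishes_below [OF assms] this, of i]
    have "hom_comp (i + (n - i)) (q i * (mv_const \<epsilon> * fps_psum (q_log (n - i)))) =
        hom_comp i (q i) * hom_comp (n - i) (mv_const \<epsilon> * fps_psum (q_log (n - i)))" .
    moreover have "i + (n - i) = n" using i by simp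
    ultimately show "hom_comp n (q i * (mv_const \<epsilon> * fps_psum (q_log (n - i)))) =
        hom_comp i (q i) * hom_comp (n - i) (mv_const \<epsilon> * fps_psum (q_log (n - i)))"
      by (simp only:)
  qed
  also have "\<dots> = (\<Sum>i=0..n. hom_comp i (q i) * (mv_const (\<epsilon> * (1 - (-1) ^ (n - i))) * psum (n - i)))"
    by (simp add: hom_comp_const_mult hom_comp_q_log)
  finally show ?thesis .
qed


section \<open>Spanning sets for the odd power sum products\<close>

text \<open>The recursion satisfied by the lowest components of \<open>q\<close>, that is, by the case \<open>\<beta> = 0\<close>.\<close>

locale odd_newton =
  fixes \<epsilon> :: rat_beta and Q :: "nat \<Rightarrow> rat_beta mvps"
  assumes eps: "\<epsilon> \<noteq> 0" and Q_0: "Q 0 = 1"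
    and Q_rec: "\<And>n. of_nat n * Q n =
      (\<Sum>i=0..n. Q i * (mv_const (\<epsilon> * (1 - (-1) ^ (n - i))) * psum (n - i)))"
begin

text \<open>With \<open>Q(z) = \<Sum> Q\<^sub>n z\<^sup>n\<close>, the logarithmic derivative \<open>z Q'/Q\<close> is odd, hence \<open>Q(z) Q(-z)\<close> is constant.\<close>

lemma alternating_sum:
  assumes "n > 0"
  shows "(\<Sum>i=0..n. (-1) ^ i * Q i * Q (n - i)) = 0"
proof -
  define S where "S = Abs_fps (\<lambda>k. mv_const (\<epsilon> * (1 - (-1) ^ k)) * psum k)"
  define A B where "A = Abs_fps Q" and "B = Abs_fps (\<lambda>n. (-1) ^ n * Q n)"
  have S: "(-1) ^ k * fps_nth S k = - fps_nth S k" for k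
    by (cases "even k") (simp_all add: S_def)
  have A: "fps_X * fps_deriv A = A * S"
    by (rule fps_ext, unfold fps_nth_X_deriv) (simp add: fps_mult_nth A_def S_def Q_rec)
  have "fps_X * fps_deriv B = - (B * S)"
  proof (rule fps_ext)
    fix n
    have "fps_nth (fps_X * fps_deriv B) n = (-1) ^ n * (of_nat n * Q n)"
      unfolding fps_nth_X_deriv by (simp add: B_def mult_ac)
    also have "\<dots> = (-1) ^ n * (\<Sum>i=0..n. Q i * fps_nth S (n - i))"
      by (simp add: Q_rec S_def)
    also have "\<dots> = (\<Sum>i=0..n. ((-1) ^ i * Q i) * ((-1) ^ (n - i) * fps_nth S (n - i)))"
      unfolding sum_distrib_left
    proof (rule sum.cong [OF refl])
      fix i assume "i \<in> {0..n}"
      then have "(-1 :: rat_beta mvps) ^ n = (-1) ^ i * (-1) ^ (n - i)" by (simp add: power_add [symmetric])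
      then show "(-1) ^ n * (Q i * fps_nth S (n - i)) =
          ((-1) ^ i * Q i) * ((-1) ^ (n - i) * fps_nth S (n - i))" by (simp only: mult_ac)
    qed
    also have "\<dots> = fps_nth (- (B * S)) n"
      by (simp add: S fps_mult_nth B_def sum_negf)
    finally show "fps_nth (fps_X * fps_deriv B) n = fps_nth (- (B * S)) n" .
  qed
  \<comment> \<open>\<open>B\<close> is Q(-z). Its logarithmic derivative is the negative of that of
    \<open>A\<close>, so the product is constant.\<close>
  then have "fps_X * fps_deriv (B * A) = 0"
    using A by (simp add: distrib_left mult.left_commute [of fps_X] algebra_simps)
  then have "of_nat n * fps_nth (B * A) n = 0"
    by (simp only: fps_nth_X_deriv [symmetric] fps_zero_nth)
  then have "mv_const (1 / of_nat n) * (mv_const (of_nat n) * fps_nth (B * A) n) = 0"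
    by (simp add: mv_const_of_nat)
  then show ?thesis using assms by (simp add: fps_mult_nth A_def B_def)
qed

lemma part_prod_filter_pos: "part_prod Q (filter_mset (\<lambda>k. k > 0) l) = part_prod Q l"
  by (induction l) (auto simp: Q_0)

text \<open>At odd \<open>n\<close> the term i = 0 of the recursion is 2 \<epsilon> p_n, and the
  others contain only smaller odd power sums; solve for p_n.\<close>

lemma psum_in_span_Q:
  assumes "odd n"
  shows "psum n \<in> part_span partitions Q n"
  using assms
proof (induction n rule: less_induct)
  case (less n)
  then have n: "n > 0" by (auto intro: gr0I)
  have Q: "Q i \<in> part_span partitions Q i" for i
  proof (cases "i = 0")
    case True
    then show ?thesis by (simp add: Q_0 part_span_1 partitions_def)
  next
    case False
    then show ?thesis using part_span_base [of "{#i#}" partitions i Q] by (simp add: partitions_def)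
  qed
  let ?t = "\<lambda>i. Q i * (mv_const (\<epsilon> * (1 - (-1) ^ (n - i))) * psum (n - i))"
  have t: "?t i \<in> part_span partitions Q n" if "i \<in> {1..n}" for i
  proof (cases "odd (n - i)")
    case True
    with that less.IH [of "n - i"] have "psum (n - i) \<in> part_span partitions Q (n - i)" by simp
    then have "?t i \<in> part_span partitions Q (i + (n - i))"
      by (intro part_span_mult partitions_add Q mvs.span_scale)
    then show ?thesis using that by simp
  qed (simp add: mvs.span_zero)
  have "of_nat n * Q n = ?t 0 + (\<Sum>i=1..n. ?t i)"
    unfolding Q_rec by (simp add: sum.atLeast_Suc_atMost)
  moreover have "?t 0 = mv_const (2 * \<epsilon>) * psum n"
    using less.prems by (simp add: Q_0 mult.commute)
  ultimately have "mv_const (2 * \<epsilon>) * psum n = mv_const (of_nat n) * Q n - (\<Sum>i=1..n. ?t i)"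
    by (simp add: mv_const_of_nat)
  also have "\<dots> \<in> part_span partitions Q n"
    by (intro mvs.span_diff mvs.span_scale mvs.span_sum Q t)
  finally have "mv_const (1 / (2 * \<epsilon>)) * (mv_const (2 * \<epsilon>) * psum n) \<in> part_span partitions Q n"
    by (rule mvs.span_scale)
  then show ?case using eps by simp
qed

lemma part_prod_psum_in_span_Q:
  assumes "l \<in> odd_partitions"
  shows "part_prod psum l \<in> part_span partitions Q (sum_mset l)"
  using assms
proof (induction l)
  case empty
  show ?case by (simp add: part_span_1 partitions_def)
next
  case (add k l)
  then have "odd k" "l \<in> odd_partitions" by (auto simp: odd_partitions_def partitions_def)
  with add.IH show ?case by (simp add: part_span_mult partitions_add psum_in_span_Q)
qed

text \<open>For even positive \<open>n\<close> the relation Q(z) Q(-z) = 1 contains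
  \<open>Q n\<close> twice with the same sign, next to products of smaller indices.\<close>

lemma Q_in_span_odd: "Q n \<in> part_span odd_partitions Q n"
proof (induction n rule: less_induct)
  case (less n)
  consider "n = 0" | "odd n" | "even n" "n > 0" by (metis not_gr_zero)
  then show ?case
  proof cases
    case 1
    then show ?thesis by (simp add: Q_0 part_span_1 odd_partitions_def partitions_def)
  next
    case 2
    then have "{#n#} \<in> odd_partitions" by (auto simp: odd_partitions_def partitions_def odd_pos)
    then show ?thesis using part_span_base [of "{#n#}" odd_partitions n Q] by simp
  next
    case 3
    let ?t = "\<lambda>i. mv_const ((-1) ^ i) * (Q i * Q (n - i))"
    have c: "(-1) ^ i * Q i * Q (n - i) = ?t i" for i
      by (cases "even i") (simp_all add: mv_const_uminus)
    have "(\<Sum>i=0..n. ?t i) = 0"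
      using alternating_sum [OF 3(2)] by (simp only: c)
    moreover have "(\<Sum>i=0..n. ?t i) = ?t 0 + (\<Sum>i\<in>{1..<n}. ?t i) + ?t n"
    proof -
      have "{0..n} = insert 0 (insert n {1..<n})" using 3 by auto
      then show ?thesis using 3 by (simp add: algebra_simps)
    qed
    ultimately have "mv_const 2 * Q n = - (\<Sum>i\<in>{1..<n}. ?t i)"
      using 3 mv_const_of_nat [where 'a = rat_beta, of 2]
      by (simp add: Q_0 algebra_simps eq_neg_iff_add_eq_0 mult_2)
    also have "\<dots> \<in> part_span odd_partitions Q n"
    proof (intro mvs.span_neg mvs.span_sum mvs.span_scale)
      fix i assume i: "i \<in> {1..<n}"
      then have "Q i * Q (n - i) \<in> part_span odd_partitions Q (i + (n - i))"
        by (intro part_span_mult odd_partitions_add less) auto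
      then show "Q i * Q (n - i) \<in> part_span odd_partitions Q n" using i by simp
    qed
    finally have "mv_const (1 / 2) * (mv_const 2 * Q n) \<in> part_span odd_partitions Q n"
      by (rule mvs.span_scale)
    then show ?thesis by simp
  qed
qed

lemma part_prod_Q_in_span_odd: "part_prod Q l \<in> part_span odd_partitions Q (sum_mset l)"
proof (induction l)
  case empty
  show ?case by (simp add: part_span_1 partitions_def odd_partitions_def)
next
  case (add k l)
  then show ?case by (simp add: part_span_mult odd_partitions_add Q_in_span_odd)
qed

text \<open>
  \<open>Q(z) Q(-z) = 1\<close> rewrites a product with a repeated part as a combination of products with a
  larger sum of squares of the parts.
\<close>

lemma part_prod_Q_in_span_strict: "part_prod Q l \<in> part_span strict_partitions Q (sum_mset l)"
proof (induction "(sum_mset l)\<^sup>2 - (\<Sum>k\<in>#l. k\<^sup>2)" arbitrary: l rule: less_induct)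
  case less
  \<comment> \<open>Rewriting may create parts equal to 0. They are kept during the induction and
    stripped here, which is harmless because \<open>Q 0\<close> is 1.\<close>
  let ?l = "filter_mset (\<lambda>k. k > 0) l" and ?d = "sum_mset l"
  have sum_filter: "sum_mset ?l = ?d" by (induction l) auto
  show ?case
  proof (cases "?l \<in> strict_partitions")
    case True
    then show ?thesis
      using part_span_base [OF True sum_filter, of Q] by (simp add: part_prod_filter_pos)
  next
    case False
    then obtain n where n: "n > 0" "n \<in># l" "count l n \<noteq> 1"
      by (auto simp: strict_partitions_def partitions_def split: if_splits)
    then have "count l n \<ge> 2" by (metis One_nat_def Suc_1 count_greater_zero_iff le_neq_implies_less Suc_leI)
    then have "replicate_mset 2 n \<subseteq># l" by (simp add: count_le_replicate_mset_subset_eq)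
    then obtain l' where "l = replicate_mset 2 n + l'" by (metis subset_mset.add_diff_inverse)
    then have l: "l = add_mset n (add_mset n l')" by (simp add: numeral_2_eq_2)
    \<comment> \<open>The sum of the parts is preserved by rewriting, so its square bounds the
      growing sum of squares and the induction measure drops strictly.\<close>
    have sq: "(\<Sum>k\<in>#r. k\<^sup>2) \<le> (sum_mset r)\<^sup>2" for r :: "nat multiset"
      by (induction r) (auto simp: power2_sum)
    let ?t = "\<lambda>i. mv_const ((-1) ^ i) * part_prod Q (add_mset i (add_mset (2 * n - i) l'))"
    have t: "?t i \<in> part_span strict_partitions Q ?d" if i: "i \<in> {0..2 * n} - {n}" for i
    proof -
      let ?r = "add_mset i (add_mset (2 * n - i) l')"
      have d: "sum_mset ?r = ?d" using i by (simp add: l)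
      \<comment> \<open>Moving two equal parts \<open>n\<close> apart with fixed sum raises the sum
        of squares by 2 (i - n)^2.\<close>
      have "2 * n\<^sup>2 < i\<^sup>2 + (2 * n - i)\<^sup>2"
      proof -
        have "0 < (int i - int n)\<^sup>2" using i by simp
        then have "2 * (int n)\<^sup>2 < (int i)\<^sup>2 + (2 * int n - int i)\<^sup>2"
          by (simp add: power2_eq_square algebra_simps)
        also have "2 * int n - int i = int (2 * n - i)" using i by simp
        finally show ?thesis unfolding of_nat_power [symmetric] by linarith
      qed
      then have "(\<Sum>k\<in>#l. k\<^sup>2) < (\<Sum>k\<in>#?r. k\<^sup>2)" by (simp add: l)
      then have "(sum_mset ?r)\<^sup>2 - (\<Sum>k\<in>#?r. k\<^sup>2) < (sum_mset l)\<^sup>2 - (\<Sum>k\<in>#l. k\<^sup>2)"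
        using sq [of ?r] unfolding d by linarith
      from less [OF this] show ?thesis
        unfolding d by (rule mvs.span_scale)
    qed
    have c: "(-1) ^ i * Q i * Q (2 * n - i) * part_prod Q l' = ?t i" for i
      by (cases "even i") (simp_all add: mv_const_uminus mult.assoc)
    have "(\<Sum>i=0..2 * n. ?t i) = (\<Sum>i=0..2 * n. (-1) ^ i * Q i * Q (2 * n - i)) * part_prod Q l'"
      by (simp only: sum_distrib_right c)
    also have "\<dots> = 0" using alternating_sum [of "2 * n"] n by simp
    finally have "?t n + (\<Sum>i\<in>{0..2 * n} - {n}. ?t i) = 0"
      by (subst sum.remove [symmetric]) auto
    moreover have "?t n = mv_const ((-1) ^ n) * part_prod Q l" by (simp add: l mult_2)
    ultimately have "mv_const ((-1) ^ n) * part_prod Q l = - (\<Sum>i\<in>{0..2 * n} - {n}. ?t i)"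
      by (simp add: eq_neg_iff_add_eq_0)
    also have "\<dots> \<in> part_span strict_partitions Q ?d"
      by (intro mvs.span_neg mvs.span_sum t)
    finally have "mv_const ((-1) ^ n) * (mv_const ((-1) ^ n) * part_prod Q l)
        \<in> part_span strict_partitions Q ?d"
      by (rule mvs.span_scale)
    then show ?thesis by (simp add: mv_const_mult [symmetric] mult.assoc [symmetric] power_add [symmetric] del: mvs.scale_scale)
  qed
qed

lemma part_span_subset_strict: "part_span partitions Q d \<subseteq> part_span strict_partitions Q d"
proof (rule mvs.span_minimal [OF _ mvs.subspace_span])
  show "part_prod Q ` deg_part partitions d \<subseteq> part_span strict_partitions Q d"
    using part_prod_Q_in_span_strict unfolding deg_part_def by blast
qed

lemma part_span_subset_odd: "part_span partitions Q d \<subseteq> part_span odd_partitions Q d"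
proof (rule mvs.span_minimal [OF _ mvs.subspace_span])
  show "part_prod Q ` deg_part partitions d \<subseteq> part_span odd_partitions Q d"
    using part_prod_Q_in_span_odd unfolding deg_part_def by blast
qed

lemma part_prod_psum_in_span_odd:
  assumes "l \<in> deg_part odd_partitions d"
  shows "part_prod psum l \<in> part_span odd_partitions Q d"
  using assms part_prod_psum_in_span_Q part_span_subset_odd unfolding deg_part_def by blast

lemma part_prod_psum_in_span_strict:
  assumes "l \<in> deg_part odd_partitions d"
  shows "part_prod psum l \<in> part_span strict_partitions Q d"
  using assms part_prod_psum_in_span_Q part_span_subset_strict unfolding deg_part_def by blast

end


section \<open>Glaisher's map\<close>

definition odd_part :: "nat \<Rightarrow> nat" where
  "odd_part n = n div 2 ^ multiplicity 2 n"

definition glaisher :: "nat multiset \<Rightarrow> nat multiset" where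
  "glaisher l = (\<Sum>n\<in>#l. replicate_mset (2 ^ multiplicity 2 n) (odd_part n))"

lemma odd_odd_part: "n > 0 \<Longrightarrow> odd (odd_part n)"
  unfolding odd_part_def by (rule multiplicity_decompose) auto

lemma odd_part_mult: "2 ^ multiplicity 2 n * odd_part n = n"
  unfolding odd_part_def by (simp add: multiplicity_dvd)

lemma sum_mset_glaisher: "sum_mset (glaisher l) = sum_mset l"
proof (induction l)
  case (add n l)
  then show ?case using odd_part_mult [of n] by (simp add: glaisher_def)
qed (simp add: glaisher_def)

lemma in_glaisher: "k \<in># glaisher l \<Longrightarrow> \<exists>n\<in>#l. k = odd_part n"
  by (induction l) (auto simp: glaisher_def split: if_splits)

lemma glaisher_odd: "l \<in> partitions \<Longrightarrow> glaisher l \<in> odd_partitions"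
proof -
  assume "l \<in> partitions"
  then have "odd k" if "k \<in># glaisher l" for k
    using in_glaisher [OF that] by (auto simp: partitions_def intro!: odd_odd_part gr0I)
  then show ?thesis by (auto simp: odd_partitions_def partitions_def)
qed

text \<open>Distinct parts 2^a k contribute distinct powers of two, so the multiplicity of an odd
  \<open>k\<close> lists in binary which 2^a k are parts.\<close>

lemma count_glaisher:
  assumes "l \<in> strict_partitions" "odd k"
  shows "count (glaisher l) k = set_encode {a. 2 ^ a * k \<in># l}"
proof -
  have cnt: "count (glaisher r) k = (\<Sum>n\<in>#r. if odd_part n = k then 2 ^ multiplicity 2 n else 0)" for r
    by (induction r) (auto simp: glaisher_def)
  have "l = mset_set (set_mset l)"
    using assms(1) by (auto simp: strict_partitions_def multiset_eq_iff count_mset_set' count_eq_zero_iff)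
  then have "count (glaisher l) k = (\<Sum>n\<in>set_mset l. if odd_part n = k then 2 ^ multiplicity 2 n else 0)"
    unfolding cnt by (metis (no_types) sum_unfold_sum_mset)
  also have "\<dots> = (\<Sum>n\<in>{n \<in> set_mset l. odd_part n = k}. 2 ^ multiplicity 2 n)"
    by (simp add: sum.inter_filter)
  also have "\<dots> = (\<Sum>a\<in>{a. 2 ^ a * k \<in># l}. 2 ^ a)"
  proof (rule sum.reindex_bij_witness [where j = "multiplicity 2" and i = "\<lambda>a. 2 ^ a * k"])
    fix a assume a: "a \<in> {a. 2 ^ a * k \<in># l}"
    have mult: "multiplicity 2 (2 ^ a * k) = a"
      using assms(2) by (intro multiplicity_eqI) auto
    show "multiplicity 2 (2 ^ a * k) = a" by (rule mult)
    show "2 ^ a * k \<in> {n \<in> set_mset l. odd_part n = k}"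
      using a by (simp add: odd_part_def mult)
  qed (use odd_part_mult in auto)
  finally show ?thesis by (simp add: set_encode_def)
qed

lemma glaisher_inj: "inj_on glaisher strict_partitions"
proof (rule inj_onI)
  fix l l' assume l: "l \<in> strict_partitions" "l' \<in> strict_partitions" and eq: "glaisher l = glaisher l'"
  \<comment> \<open>\<open>set_encode\<close> can be inverted only on finite sets of
    exponents.\<close>
  have fin: "finite {a. 2 ^ a * k \<in># r}" if "odd k" for k and r :: "nat multiset"
  proof (rule inj_on_finite [of "\<lambda>a. 2 ^ a * k" _ "set_mset r"])
    show "inj_on (\<lambda>a. 2 ^ a * k) {a. 2 ^ a * k \<in># r}"
      using that by (auto simp: inj_on_def odd_pos)
  qed auto
  have "n \<in># l \<longleftrightarrow> n \<in># l'" for n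
  proof (cases "n = 0")
    case True
    then show ?thesis using l by (auto simp: strict_partitions_def partitions_def)
  next
    case False
    then have odd: "odd (odd_part n)" by (simp add: odd_odd_part)
    from count_glaisher [OF l(1) odd] count_glaisher [OF l(2) odd] eq
    have "set_encode {a. 2 ^ a * odd_part n \<in># l} = set_encode {a. 2 ^ a * odd_part n \<in># l'}" by simp
    then have "{a. 2 ^ a * odd_part n \<in># l} = {a. 2 ^ a * odd_part n \<in># l'}"
      by (simp add: set_encode_eq fin odd)
    then have "2 ^ multiplicity 2 n * odd_part n \<in># l \<longleftrightarrow> 2 ^ multiplicity 2 n * odd_part n \<in># l'"
      by blast
    then show ?thesis by (simp only: odd_part_mult)
  qed
  note mem = this
  have "count l n = count l' n" for n
  proof (cases "n \<in># l")
    case True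
    with mem [of n] l show ?thesis by (simp add: strict_partitions_def)
  next
    case False
    with mem [of n] show ?thesis by (simp add: not_in_iff)
  qed
  then show "l = l'" by (rule multiset_eqI)
qed

lemma card_strict_le_card_odd:
  "card (deg_part strict_partitions d) \<le> card (deg_part odd_partitions d)"
proof (rule card_inj_on_le [of glaisher])
  show "inj_on glaisher (deg_part strict_partitions d)"
    using glaisher_inj by (rule inj_on_subset) (auto simp: deg_part_def)
  show "glaisher ` deg_part strict_partitions d \<subseteq> deg_part odd_partitions d"
    using strict_partitions_subset by (auto simp: deg_part_def sum_mset_glaisher glaisher_odd)
  show "finite (deg_part odd_partitions d)"
    by (rule finite_deg_part [OF odd_partitions_subset])
qed


section \<open>Expansions in families with independent lowest components\<close>

text \<open>Dimension count: the span contains as many independent products p_\<lambda> as there are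
  odd partitions, so a family with at most that many members admits no nontrivial relation.\<close>

lemma independent_of_spanning:
  assumes I: "I \<subseteq> partitions" "card (deg_part I d) \<le> card (deg_part odd_partitions d)"
    and span: "\<And>l. l \<in> deg_part odd_partitions d \<Longrightarrow> part_prod psum l \<in> mvs.span (B ` deg_part I d)"
    and zero: "(\<Sum>l\<in>deg_part I d. mv_const (c l) * B l) = 0"
    and l: "l \<in> deg_part I d"
  shows "c l = 0"
proof (rule ccontr)
  assume nz: "c l \<noteq> 0"
  let ?O = "deg_part odd_partitions d" and ?I = "deg_part I d"
  have fin: "finite ?I" "finite ?O"
    by (simp_all add: finite_deg_part I odd_partitions_subset)
  have O: "?O \<subseteq> partitions" using odd_partitions_subset by (auto simp: deg_part_def)
  have inj: "inj_on (part_prod psum) ?O"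
  proof (rule inj_onI, rule ccontr)
    fix a b assume ab: "a \<in> ?O" "b \<in> ?O" "part_prod psum a = part_prod psum b" "a \<noteq> b"
    let ?c = "\<lambda>x. if x = a then 1 else -1 :: rat_beta"
    have "(\<Sum>x\<in>{a, b}. mv_const (?c x) * part_prod psum x) = 0"
      using ab by (simp add: mv_const_uminus)
    then have "?c a = 0" by (rule part_prod_psum_independent [rotated 2]) (use ab O in auto)
    then show False by simp
  qed
  have indep: "mvs.independent (part_prod psum ` ?O)"
  proof
    assume "mvs.dependent (part_prod psum ` ?O)"
    then obtain u where u: "\<exists>v\<in>part_prod psum ` ?O. u v \<noteq> 0"
      and "(\<Sum>v\<in>part_prod psum ` ?O. mv_const (u v) * v) = 0"
      using fin by (auto simp: mvs.dependent_finite)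
    then have "(\<Sum>x\<in>?O. mv_const (u (part_prod psum x)) * part_prod psum x) = 0"
      by (simp add: sum.reindex inj)
    then have "u (part_prod psum x) = 0" if "x \<in> ?O" for x
      using that by (rule part_prod_psum_independent [OF fin(2) O])
    with u show False by blast
  qed
  \<comment> \<open>A nonzero \<open>c l\<close> would make \<open>B l\<close> redundant, leaving
    fewer generators than independent vectors in their span.\<close>
  let ?S = "B ` (?I - {l})"
  have "mv_const (c l) * B l + (\<Sum>x\<in>?I - {l}. mv_const (c x) * B x) = 0"
    using zero by (simp add: sum.remove [OF fin(1) l])
  then have "mv_const (c l) * B l = - (\<Sum>x\<in>?I - {l}. mv_const (c x) * B x)"
    by (simp add: eq_neg_iff_add_eq_0)
  also have "\<dots> \<in> mvs.span ?S"
    by (intro mvs.span_neg mvs.span_sum mvs.span_scale mvs.span_base) auto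
  finally have "mv_const (1 / c l) * (mv_const (c l) * B l) \<in> mvs.span ?S"
    by (rule mvs.span_scale)
  then have Bl: "B l \<in> mvs.span ?S" using nz by simp
  have "B ` ?I \<subseteq> mvs.span ?S"
  proof
    fix y assume "y \<in> B ` ?I"
    then obtain x where "x \<in> ?I" "y = B x" by blast
    with Bl show "y \<in> mvs.span ?S" by (cases "x = l") (auto intro: mvs.span_base)
  qed
  then have "mvs.span (B ` ?I) \<subseteq> mvs.span ?S"
    by (rule mvs.span_minimal) (rule mvs.subspace_span)
  with span have "part_prod psum ` ?O \<subseteq> mvs.span ?S" by blast
  then have "card (part_prod psum ` ?O) \<le> card ?S"
    using mvs.independent_span_bound [OF _ indep] fin by simp
  also have "\<dots> \<le> card (?I - {l})" using fin by (simp add: card_image_le)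
  also have "\<dots> < card ?I" using fin(1) l by (rule card_Diff1_less)
  finally show False using I(2) by (simp add: card_image inj)
qed

text \<open>As \<open>b l\<close> starts in degree |l|, only the finitely many l with |l| at most d
  reach degree d. Convergence is automatic and the sum can be grouped by |l|.\<close>

lemma is_inf_lincomb_iff:
  fixes b :: "nat multiset \<Rightarrow> 'a::comm_ring_1 mvps"
  assumes I: "I \<subseteq> partitions" and b: "\<And>l. l \<in> I \<Longrightarrow> vanishes_below (sum_mset l) (b l)"
  shows "is_inf_lincomb I b c f \<longleftrightarrow>
    (\<forall>d. hom_comp d f = (\<Sum>k\<le>d. \<Sum>l\<in>deg_part I k. mv_const (c l) * hom_comp d (b l)))"
proof -
  have "finite {l \<in> I. hom_comp d (mv_const (c l) * b l) \<noteq> 0} \<and>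
    (\<Sum>l | l \<in> I \<and> hom_comp d (mv_const (c l) * b l) \<noteq> 0. hom_comp d (mv_const (c l) * b l)) =
    (\<Sum>k\<le>d. \<Sum>l\<in>deg_part I k. mv_const (c l) * hom_comp d (b l))" for d
  proof -
    let ?N = "{l \<in> I. hom_comp d (mv_const (c l) * b l) \<noteq> 0}"
    let ?U = "\<Union>k\<le>d. deg_part I k"
    have fin: "finite ?U" by (intro finite_UN_I finite_deg_part I) auto
    have sub: "?N \<subseteq> ?U"
      using hom_comp_eq_0 [OF b] by (force simp: hom_comp_const_mult deg_part_def intro: leI)
    have "(\<Sum>l\<in>?N. hom_comp d (mv_const (c l) * b l)) = (\<Sum>l\<in>?U. hom_comp d (mv_const (c l) * b l))"
      by (rule sum.mono_neutral_left [OF fin sub]) (auto simp: deg_part_def)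
    also have "\<dots> = (\<Sum>k\<le>d. \<Sum>l\<in>deg_part I k. hom_comp d (mv_const (c l) * b l))"
      by (rule sum.UNION_disjoint) (auto simp: deg_part_def finite_deg_part [OF I, unfolded deg_part_def])
    finally show ?thesis
      using finite_subset [OF sub fin] by (simp add: hom_comp_const_mult)
  qed
  then show ?thesis unfolding is_inf_lincomb_def by simp
qed

text \<open>
  The coefficients are found degree by degree: subtracting a combination of the \<open>b \<lambda>\<close> with \<open>|\<lambda>| = d\<close>
  removes the component of degree \<open>d\<close> and stays inside \<^const>\<open>GG\<close>.
\<close>

lemma uniquely_expressible_GG:
  fixes b :: "nat multiset \<Rightarrow> rat_beta mvps"
  assumes I: "I \<subseteq> partitions" "\<And>d. card (deg_part I d) \<le> card (deg_part odd_partitions d)"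
    and b: "\<And>l. l \<in> I \<Longrightarrow> vanishes_below (sum_mset l) (b l)" "\<And>l. l \<in> I \<Longrightarrow> b l \<in> GG"
    and span: "\<And>d l. l \<in> deg_part odd_partitions d \<Longrightarrow>
      part_prod psum l \<in> mvs.span ((\<lambda>l. hom_comp d (b l)) ` deg_part I d)"
    and f: "f \<in> GG"
  shows "uniquely_expressible I b f"
proof -
  have fin: "finite (deg_part I d)" for d by (rule finite_deg_part [OF I(1)])
  have in_I: "l \<in> I" "sum_mset l = d" if "l \<in> deg_part I d" for l d
    using that by (auto simp: deg_part_def)
  have step: "\<exists>h. (h \<in> GG \<and> vanishes_below (Suc d) h) \<and>
      (\<exists>a. h = g - (\<Sum>l\<in>deg_part I d. mv_const (a l) * b l))"
    if g: "g \<in> GG \<and> vanishes_below d g" for g d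
  proof -
    \<comment> \<open>The lowest component of \<open>g\<close> is a combination of odd power sum
      products, hence of the lowest components of the \<open>b l\<close>.\<close>
    have "part_span odd_partitions psum d \<subseteq> mvs.span ((\<lambda>l. hom_comp d (b l)) ` deg_part I d)"
      by (rule mvs.span_minimal) (auto intro: span)
    with lowest_component_GG g
    have "hom_comp d g \<in> mvs.span ((\<lambda>l. hom_comp d (b l)) ` deg_part I d)" by blast
    then obtain a where a: "hom_comp d g = (\<Sum>l\<in>deg_part I d. mv_const (a l) * hom_comp d (b l))"
      using fin by (elim span_imageE)
    let ?h = "g - (\<Sum>l\<in>deg_part I d. mv_const (a l) * b l)"
    have "?h \<in> GG"
      using g by (intro GG_diff GG_sum GG_const_mult b(2)) (auto dest: in_I)
    moreover have "vanishes_below (Suc d) ?h"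
      unfolding vanishes_below_def
    proof (intro allI impI)
      fix m :: "nat multiset" assume "size m < Suc d"
      then consider "size m < d" | "size m = d" by linarith
      then show "mv_coeff ?h m = 0"
      proof cases
        case 1
        have "vanishes_below d (\<Sum>l\<in>deg_part I d. mv_const (a l) * b l)"
          by (intro vanishes_below_sum vanishes_below_const_mult) (auto simp: deg_part_def intro: b)
        then show ?thesis using 1 g by (simp add: vanishes_below_def)
      next
        case 2
        have "hom_comp d ?h = 0" by (simp add: hom_comp_diff hom_comp_sum hom_comp_const_mult a)
        then have "mv_coeff (hom_comp d ?h) m = 0" by simp
        then show ?thesis using 2 by simp
      qed
    qed
    ultimately show ?thesis by blast
  qed
  have "\<exists>F. \<forall>d. (F d \<in> GG \<and> vanishes_below d (F d) \<and> (d = 0 \<longrightarrow> F d = f)) \<and>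
      (\<exists>a. F (Suc d) = F d - (\<Sum>l\<in>deg_part I d. mv_const (a l) * b l))"
    by (rule dependent_nat_choice) (use f step in auto)
  then obtain F where F': "\<And>d. (F d \<in> GG \<and> vanishes_below d (F d) \<and> (d = 0 \<longrightarrow> F d = f)) \<and>
      (\<exists>a. F (Suc d) = F d - (\<Sum>l\<in>deg_part I d. mv_const (a l) * b l))"
    by blast
  then have F: "vanishes_below d (F d)" "F 0 = f" for d by blast+
  have "\<exists>a. \<forall>d. F (Suc d) = F d - (\<Sum>l\<in>deg_part I d. mv_const (a d l) * b l)"
    by (rule choice) (use F' in blast)
  then obtain a where a: "F (Suc d) = F d - (\<Sum>l\<in>deg_part I d. mv_const (a d l) * b l)" for d
    by blast
  have expansion: "hom_comp d f = (\<Sum>k\<le>d. \<Sum>l\<in>deg_part I k. mv_const (c l) * hom_comp d (b l))"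
    if "is_inf_lincomb I b c f" for c d
    using that is_inf_lincomb_iff [of I b c f] I(1) b(1) by simp
  \<comment> \<open>The coefficient of \<open>l\<close> is fixed at stage |l|; outside
    \<open>I\<close> it takes the prescribed value 0.\<close>
  define c where "c l = (if l \<in> I then a (sum_mset l) l else 0)" for l
  have partial: "f = F n + (\<Sum>k<n. \<Sum>l\<in>deg_part I k. mv_const (c l) * b l)" for n
  proof (induction n)
    case (Suc n)
    have "(\<Sum>l\<in>deg_part I n. mv_const (a n l) * b l) = (\<Sum>l\<in>deg_part I n. mv_const (c l) * b l)"
      by (rule sum.cong) (auto simp: c_def deg_part_def)
    then show ?case by (subst Suc) (simp add: a)
  qed (simp add: F)
  have "hom_comp d f = (\<Sum>k\<le>d. \<Sum>l\<in>deg_part I k. mv_const (c l) * hom_comp d (b l))" for d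
  proof -
    have "hom_comp d (F (Suc d)) = 0" by (rule hom_comp_eq_0 [OF F(1)]) simp
    then show ?thesis
      by (subst partial [of "Suc d"])
        (simp add: hom_comp_add hom_comp_sum hom_comp_const_mult lessThan_Suc_atMost)
  qed
  then have c: "(\<forall>l. l \<notin> I \<longrightarrow> c l = 0) \<and> is_inf_lincomb I b c f"
    using is_inf_lincomb_iff [of I b c f] I(1) b(1) by (simp add: c_def)
  show ?thesis
    unfolding uniquely_expressible_def
  proof (rule ex1I [of _ c], rule c)
    fix c' assume c': "(\<forall>l. l \<notin> I \<longrightarrow> c' l = 0) \<and> is_inf_lincomb I b c' f"
    have eq: "(\<Sum>k\<le>d. \<Sum>l\<in>deg_part I k. mv_const (c' l - c l) * hom_comp d (b l)) = 0" for d
    proof -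
      have "(\<Sum>k\<le>d. \<Sum>l\<in>deg_part I k. mv_const (c' l) * hom_comp d (b l)) =
          (\<Sum>k\<le>d. \<Sum>l\<in>deg_part I k. mv_const (c l) * hom_comp d (b l))"
        using c [THEN conjunct2, THEN expansion] c' [THEN conjunct2, THEN expansion] by simp
      then show ?thesis
        by (simp add: mvs.scale_left_diff_distrib sum_subtractf)
    qed
    \<comment> \<open>Once the lower coefficients agree, degree \<open>d\<close> of the difference
      is a relation among independent lowest components.\<close>
    have "\<forall>l\<in>deg_part I d. c' l - c l = 0" for d
    proof (induction d rule: less_induct)
      case (less d)
      have "(\<Sum>l\<in>deg_part I k. mv_const (c' l - c l) * hom_comp d (b l)) = 0" if "k < d" for k
        using less [OF that] by (intro sum.neutral) simp
      then have "(\<Sum>k<d. \<Sum>l\<in>deg_part I k. mv_const (c' l - c l) * hom_comp d (b l)) = 0"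
        by (intro sum.neutral) simp
      then have "(\<Sum>l\<in>deg_part I d. mv_const (c' l - c l) * hom_comp d (b l)) = 0"
        using eq [of d] unfolding lessThan_Suc_atMost [symmetric] sum.lessThan_Suc by simp
      from independent_of_spanning [OF I(1) I(2) span this] show ?case by blast
    qed
    note zero = this
    show "c' = c"
    proof
      fix l
      show "c' l = c l"
      proof (cases "l \<in> I")
        case True
        then have "l \<in> deg_part I (sum_mset l)" by (simp add: deg_part_def)
        then show ?thesis using zero by auto
      qed (use c c' in simp)
    qed
  qed
qed

text \<open>Lowest components are multiplicative, so conditions on the factors suffice. They concern
  only parts occurring in \<open>I\<close>, since \<open>pbeta k\<close> is placed in
  \<open>GG\<close> for odd k.\<close>

lemma uniquely_expressible_part_prod:
  assumes I: "I \<subseteq> partitions" "\<And>d. card (deg_part I d) \<le> card (deg_part odd_partitions d)"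
    and g: "\<And>l k. l \<in> I \<Longrightarrow> k \<in># l \<Longrightarrow> vanishes_below k (g k)" "\<And>l k. l \<in> I \<Longrightarrow> k \<in># l \<Longrightarrow> g k \<in> GG"
    and span: "\<And>d l. l \<in> deg_part odd_partitions d \<Longrightarrow>
      part_prod psum l \<in> part_span I (\<lambda>k. hom_comp k (g k)) d"
    and f: "f \<in> GG"
  shows "uniquely_expressible I (part_prod g) f"
proof (rule uniquely_expressible_GG [OF I _ _ _ f])
  show "vanishes_below (sum_mset l) (part_prod g l)" if "l \<in> I" for l
    using that by (intro vanishes_below_part_prod g)
  show "part_prod g l \<in> GG" if "l \<in> I" for l
    using that by (intro GG_part_prod g)
  show "part_prod psum l \<in> mvs.span ((\<lambda>l. hom_comp d (part_prod g l)) ` deg_part I d)"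
    if "l \<in> deg_part odd_partitions d" for d l
  proof -
    have "(\<lambda>l. hom_comp d (part_prod g l)) ` deg_part I d = part_prod (\<lambda>k. hom_comp k (g k)) ` deg_part I d"
      by (rule image_cong) (auto simp: deg_part_def g intro!: hom_comp_part_prod)
    then show ?thesis using span [OF that] by simp
  qed
qed


section \<open>The five families\<close>

lemma pbeta_conv_fps_psum: "n > 0 \<Longrightarrow> pbeta n = fps_psum (fhalf ^ n)"
  by (simp add: pbeta_def psum_conv_fps_psum subst_fps_psum_same fps_compose_power [symmetric])

text \<open>Since \<open>fhalf\<close> starts with u, the lowest component of \<open>pbeta k\<close>
  is p_k itself and spanning is immediate.\<close>

lemma uniquely_expressible_pbeta:
  assumes "f \<in> GG"
  shows "uniquely_expressible odd_partitions (part_prod pbeta) f"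
proof (rule uniquely_expressible_part_prod [OF odd_partitions_subset _ _ _ _ assms])
  fix l k assume "l \<in> odd_partitions" "k \<in># l"
  then have k: "odd k" "k > 0" by (auto simp: odd_partitions_def odd_pos)
  then show "vanishes_below k (pbeta k)"
    by (simp add: pbeta_conv_fps_psum vanishes_below_fps_psum startsby_zero_power_prefix)
  have "fhalf ^ k oo fbar = - (fhalf ^ k)"
    using k by (simp add: fps_compose_power [OF fbar_nth_0, symmetric] fhalf_compose_fbar)
  with k show "pbeta k \<in> GG" by (simp add: pbeta_conv_fps_psum GG_fps_psum)
next
  fix d l assume l: "l \<in> deg_part odd_partitions d"
  have "part_prod (\<lambda>k. hom_comp k (pbeta k)) l = part_prod psum l"
  proof (rule part_prod_cong)
    fix k assume "k \<in># l"
    with l have "k > 0" by (auto simp: deg_part_def odd_partitions_def odd_pos)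
    then show "hom_comp k (pbeta k) = psum k"
      by (simp add: pbeta_conv_fps_psum hom_comp_fps_psum startsby_zero_power_nth_same)
  qed
  with l part_span_base [of l odd_partitions d "\<lambda>k. hom_comp k (pbeta k)"]
  show "part_prod psum l \<in> part_span odd_partitions (\<lambda>k. hom_comp k (pbeta k)) d"
    by (simp add: deg_part_def)
qed simp

text \<open>The lowest components satisfy \<open>odd_newton\<close>, so both index sets span; the
  size bound is trivial for odd partitions and Glaisher's for strict ones.\<close>

lemma uniquely_expressible_newton_recursion:
  assumes q: "newton_recursion \<epsilon> q" "\<epsilon> \<noteq> 0" and f: "f \<in> GG"
  shows "uniquely_expressible odd_partitions (part_prod q) f"
    and "uniquely_expressible strict_partitions (part_prod q) f"
proof -
  interpret odd_newton \<epsilon> "\<lambda>k. hom_comp k (q k)"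
    using q by unfold_locales (simp_all add: newton_recursion_lead newton_recursion_def [of \<epsilon> q] hom_comp_1)
  note q = newton_recursion_vanishes_below [OF q(1)] newton_recursion_GG [OF q(1)]
  show "uniquely_expressible odd_partitions (part_prod q) f"
    by (rule uniquely_expressible_part_prod [OF odd_partitions_subset _ q part_prod_psum_in_span_odd f])
      simp_all
  show "uniquely_expressible strict_partitions (part_prod q) f"
    by (rule uniquely_expressible_part_prod [OF strict_partitions_subset card_strict_le_card_odd q
          part_prod_psum_in_span_strict f]) simp_all
qed

theorem theorem2p8:
  "\<forall>f\<in>GGamma.
     uniquely_expressible odd_partitions (part_prod pbeta) f \<and>
     uniquely_expressible odd_partitions (part_prod qbeta) f \<and>
     uniquely_expressible odd_partitions (part_prod qbeta_bar) f \<and>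
     uniquely_expressible strict_partitions (part_prod qbeta) f \<and>
     uniquely_expressible strict_partitions (part_prod qbeta_bar) f"
proof
  fix f assume "f \<in> GGamma"
  then have "f \<in> GG" using GGamma_subset_GG by blast
  then show "uniquely_expressible odd_partitions (part_prod pbeta) f \<and>
     uniquely_expressible odd_partitions (part_prod qbeta) f \<and>
     uniquely_expressible odd_partitions (part_prod qbeta_bar) f \<and>
     uniquely_expressible strict_partitions (part_prod qbeta) f \<and>
     uniquely_expressible strict_partitions (part_prod qbeta_bar) f"
    using uniquely_expressible_pbeta
      uniquely_expressible_newton_recursion [OF newton_recursion_qbeta]
      uniquely_expressible_newton_recursion [OF newton_recursion_qbeta_bar]
    by simp
qed

end
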